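(* Let $a_0,\dots,a_7$ be real numbers and let $M$ be an $n$-dimensional $\mathcal{T}_a$-Ricci-semisymmetric $(N(k),\xi)$-semi-Riemannian manifold. Then for all vector fields $X,Y$, $$\varepsilon a_5\,S^2(X,Y)=E\,S(X,Y)+F\,g(X,Y)+G\,\eta(X)\eta(Y),$$ where $$E=\varepsilon ka_0+\varepsilon a_7r-\varepsilon k(n-1)a_1-\varepsilon k(n-1)a_2,$$ $$F=-\varepsilon k(n-1)(ka_0+k(n-1)a_4+a_7r),$$ $$G=-k^2(n-1)^2(a_1+a_2+2a_3+a_4+a_5+2a_6).$$ In particular, if $a_5=0\neq E$, then $M$ is an $\eta$-Einstein manifold.
   Context: Let $(M,g)$ be an $n$-dimensional semi-Riemannian manifold with curvature tensor $R$, Ricci tensor $S$ (with $S(Y,Z)$ the trace of $X\mapsto R(X,Y)Z$), Ricci operator $Q$ ($g(QX,Y)=S(X,Y)$) and scalar curvature $r$; $S^2(X,Y)=S(QX,Y)$. For real numbers $a_0,\dots,a_7$, the $\mathcal{T}_a$-curvature tensor is $$\mathcal{T}_a(X,Y)Z=a_0R(X,Y)Z+a_1S(Y,Z)X+a_2S(X,Z)Y+a_3S(X,Y)Z+a_4g(Y,Z)QX+a_5g(X,Z)QY+a_6g(X,Y)QZ+a_7r\,(g(Y,Z)X-g(X,Z)Y).$$ For a real number $k$, the $k$-nullity distribution is $N(k):p\mapsto\{Z\in T_pM: R(X,Y)Z=k(g(Y,Z)X-g(X,Z)Y)\text{ for all }X,Y\in T_pM\}$. An $(N(k),\xi)$-semi-Riemannian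 manifold is a semi-Riemannian manifold with a non-null unit vector field $\xi$ belonging to $N(k)$; $g(\xi,\xi)=\varepsilon=\pm1$ and $\eta(X)=\varepsilon g(X,\xi)$. It is $\eta$-Einstein if $S=\alpha g+\beta\,\eta\otimes\eta$ for some functions $\alpha,\beta$. $M$ is $\mathcal{T}_a$-Ricci-semisymmetric if $\mathcal{T}_a(X,Y)\cdot S=0$ for all $X,Y$, i.e. $S(\mathcal{T}_a(X,Y)U,V)+S(U,\mathcal{T}_a(X,Y)V)=0$ for all $X,Y,U,V$. *)

theory Defs
  imports "HOL-Analysis.Analysis"
begin

section \<open>Smooth functions on open subsets of Euclidean space\<close>

definition pd :: "'n::finite \<Rightarrow> (real^'n \<Rightarrow> real) \<Rightarrow> real^'n \<Rightarrow> real" where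
  "pd i f x = frechet_derivative f (at x) (axis i 1)"

text \<open>The set \<open>U\<close> is always open below, so differentiability is required in the full
  neighbourhood filter \<open>at x\<close>.\<close>

fun Ck_on :: "nat \<Rightarrow> (real^'n::finite) set \<Rightarrow> (real^'n \<Rightarrow> real) \<Rightarrow> bool" where
  "Ck_on 0 U f \<longleftrightarrow> continuous_on U f"
| "Ck_on (Suc k) U f \<longleftrightarrow> (\<forall>x\<in>U. f differentiable (at x)) \<and> (\<forall>i. Ck_on k U (pd i f))"

definition smooth_on :: "(real^'n::finite) set \<Rightarrow> (real^'n \<Rightarrow> real) \<Rightarrow> bool" where
  "smooth_on U f \<longleftrightarrow> (\<forall>k. Ck_on k U f)"


section \<open>Smooth manifolds\<close>

text \<open>A chart is a domain together with a coordinate map, of which only the values on the domain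
  matter. Besides an atlas (not necessarily maximal), a manifold carries a choice \<open>pchart\<close> of a
  preferred chart around each point. It serves only to identify the tangent space at \<open>p\<close> with
  the space of component vectors \<open>real^'n\<close> in the basis of coordinate vectors of \<open>pchart M p\<close>;
  the atlas and the choice are arbitrary. The dimension is \<open>CARD('n)\<close>.\<close>

type_synonym ('p, 'n) chart = "'p set \<times> ('p \<Rightarrow> real^'n)"

record ('p, 'n) mfd =
  atlas :: "('p, 'n) chart set"
  pchart :: "'p \<Rightarrow> ('p, 'n) chart"

definition cinv :: "('p, 'n::finite) chart \<Rightarrow> real^'n \<Rightarrow> 'p" where
  "cinv c = inv_into (fst c) (snd c)"

definition cimage :: "('p, 'n::finite) chart \<Rightarrow> (real^'n) set" where
  "cimage c = snd c ` fst c"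

definition is_chart :: "('p::topological_space, 'n::finite) chart \<Rightarrow> bool" where
  "is_chart c \<longleftrightarrow> open (fst c) \<and> open (cimage c) \<and> homeomorphism (fst c) (cimage c) (snd c) (cinv c)"

definition transition :: "('p, 'n::finite) chart \<Rightarrow> ('p, 'n) chart \<Rightarrow> real^'n \<Rightarrow> real^'n" where
  "transition c c' = snd c' \<circ> cinv c"

definition carrier :: "('p, 'n::finite) mfd \<Rightarrow> 'p set" where
  "carrier M = (\<Union>c\<in>atlas M. fst c)"

definition smooth_manifold ::
  "('p::{t2_space, second_countable_topology}, 'n::finite) mfd \<Rightarrow> bool" where
  "smooth_manifold M \<longleftrightarrow>
     (\<forall>c\<in>atlas M. is_chart c) \<and>
     (\<forall>c\<in>atlas M. \<forall>c'\<in>atlas M. \<forall>i.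
        smooth_on (snd c ` (fst c \<inter> fst c')) (\<lambda>x. transition c c' x $ i)) \<and>
     (\<forall>p\<in>carrier M. pchart M p \<in> atlas M \<and> p \<in> fst (pchart M p))"

text \<open>The change of components of tangent vectors at \<open>p\<close> from the chart \<open>c\<close> to the chart \<open>c'\<close>.\<close>

definition jac :: "('p, 'n::finite) chart \<Rightarrow> ('p, 'n) chart \<Rightarrow> 'p \<Rightarrow> real^'n^'n" where
  "jac c c' p = matrix (frechet_derivative (transition c c') (at (snd c p)))"

definition smooth_function :: "('p, 'n::finite) mfd \<Rightarrow> ('p \<Rightarrow> real) \<Rightarrow> bool" where
  "smooth_function M f \<longleftrightarrow> (\<forall>c\<in>atlas M. smooth_on (cimage c) (f \<circ> cinv c))"

text \<open>A vector field assigns to \<open>p\<close> the component vector of its value with respect to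
  \<open>pchart M p\<close>; smoothness refers to its components in each fixed chart of the atlas.\<close>

definition smooth_vector_field :: "('p, 'n::finite) mfd \<Rightarrow> ('p \<Rightarrow> real^'n) \<Rightarrow> bool" where
  "smooth_vector_field M X \<longleftrightarrow> (\<forall>c\<in>atlas M. \<forall>i. smooth_on (cimage c)
     (\<lambda>x. let q = cinv c x in (jac (pchart M q) c q *v X q) $ i))"


section \<open>Semi-Riemannian metrics\<close>

type_synonym ('p, 'n) metric = "'p \<Rightarrow> real^'n \<Rightarrow> real^'n \<Rightarrow> real"

definition form_index :: "(real^'n::finite \<Rightarrow> real^'n \<Rightarrow> real) \<Rightarrow> nat" where
  "form_index B = Max (dim ` {W. subspace W \<and> (\<forall>w\<in>W. w \<noteq> 0 \<longrightarrow> B w w < 0)})"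

text \<open>\<open>gcomp M g c i j x\<close> is $g(\partial_i,\partial_j)$ for the coordinate vector fields of the
  chart \<open>c\<close>, as a function of the coordinates \<open>x\<close>.\<close>

definition gcomp :: "('p, 'n::finite) mfd \<Rightarrow> ('p, 'n) metric \<Rightarrow> ('p, 'n) chart
    \<Rightarrow> 'n \<Rightarrow> 'n \<Rightarrow> real^'n \<Rightarrow> real" where
  "gcomp M g c i j x = (let q = cinv c x; J = jac c (pchart M q) q
     in g q (J *v axis i 1) (J *v axis j 1))"

definition semi_riemannian ::
  "('p::{t2_space, second_countable_topology}, 'n::finite) mfd \<Rightarrow> ('p, 'n) metric \<Rightarrow> bool" where
  "semi_riemannian M g \<longleftrightarrow>
     smooth_manifold M \<and>
     (\<forall>p\<in>carrier M. bilinear (g p) \<and> (\<forall>x y. g p x y = g p y x) \<and>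
        (\<forall>x. (\<forall>y. g p x y = 0) \<longrightarrow> x = 0)) \<and>
     (\<forall>c\<in>atlas M. \<forall>i j. smooth_on (cimage c) (gcomp M g c i j)) \<and>
     (\<exists>\<nu>. \<forall>p\<in>carrier M. form_index (g p) = \<nu>)"


section \<open>Curvature\<close>

text \<open>\<open>christoffel M g c l i j\<close> is $\Gamma^l_{ij}$ of the Levi-Civita connection in the chart \<open>c\<close>,
  i.e. $\nabla_{\partial_i}\partial_j = \Gamma^l_{ij}\partial_l$.\<close>

definition christoffel :: "('p, 'n::finite) mfd \<Rightarrow> ('p, 'n) metric \<Rightarrow> ('p, 'n) chart
    \<Rightarrow> 'n \<Rightarrow> 'n \<Rightarrow> 'n \<Rightarrow> real^'n \<Rightarrow> real" where
  "christoffel M g c l i j x = (1/2) * (\<Sum>m\<in>UNIV.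
     matrix_inv (\<chi> a b. gcomp M g c a b x) $ l $ m *
     (pd i (gcomp M g c j m) x + pd j (gcomp M g c i m) x - pd m (gcomp M g c i j) x))"

text \<open>\<open>riem_comp M g c l i j k\<close> is the \<open>l\<close>-th component of $R(\partial_i,\partial_j)\partial_k$, where
  $R(X,Y)Z = \nabla_X\nabla_Y Z - \nabla_Y\nabla_X Z - \nabla_{[X,Y]}Z$. With this sign,
  $R(X,Y)Z = k(g(Y,Z)X - g(X,Z)Y)$ for constant curvature $k$.\<close>

definition riem_comp :: "('p, 'n::finite) mfd \<Rightarrow> ('p, 'n) metric \<Rightarrow> ('p, 'n) chart
    \<Rightarrow> 'n \<Rightarrow> 'n \<Rightarrow> 'n \<Rightarrow> 'n \<Rightarrow> real^'n \<Rightarrow> real" where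
  "riem_comp M g c l i j k x =
     pd i (christoffel M g c l j k) x - pd j (christoffel M g c l i k) x
     + (\<Sum>m\<in>UNIV. christoffel M g c l i m x * christoffel M g c m j k x
                  - christoffel M g c l j m x * christoffel M g c m i k x)"

definition Riem :: "('p, 'n::finite) mfd \<Rightarrow> ('p, 'n) metric \<Rightarrow> 'p
    \<Rightarrow> real^'n \<Rightarrow> real^'n \<Rightarrow> real^'n \<Rightarrow> real^'n" where
  "Riem M g p X Y Z = (let c = pchart M p in
     (\<chi> l. \<Sum>i\<in>UNIV. \<Sum>j\<in>UNIV. \<Sum>k\<in>UNIV. riem_comp M g c l i j k (snd c p) * X $ i * Y $ j * Z $ k))"

definition Ric :: "('p, 'n::finite) mfd \<Rightarrow> ('p, 'n) metric \<Rightarrow> 'p \<Rightarrow> real^'n \<Rightarrow> real^'n \<Rightarrow> real" where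
  "Ric M g p Y Z = trace (matrix (\<lambda>X. Riem M g p X Y Z))"

definition RicOp :: "('p, 'n::finite) mfd \<Rightarrow> ('p, 'n) metric \<Rightarrow> 'p \<Rightarrow> real^'n \<Rightarrow> real^'n" where
  "RicOp M g p X = (THE V. \<forall>Y. g p V Y = Ric M g p X Y)"

definition scal :: "('p, 'n::finite) mfd \<Rightarrow> ('p, 'n) metric \<Rightarrow> 'p \<Rightarrow> real" where
  "scal M g p = trace (matrix (RicOp M g p))"

definition Ric2 :: "('p, 'n::finite) mfd \<Rightarrow> ('p, 'n) metric \<Rightarrow> 'p \<Rightarrow> real^'n \<Rightarrow> real^'n \<Rightarrow> real" where
  "Ric2 M g p X Y = Ric M g p (RicOp M g p X) Y"

definition Ta :: "(nat \<Rightarrow> real) \<Rightarrow> ('p, 'n::finite) mfd \<Rightarrow> ('p, 'n) metric \<Rightarrow> 'p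
    \<Rightarrow> real^'n \<Rightarrow> real^'n \<Rightarrow> real^'n \<Rightarrow> real^'n" where
  "Ta a M g p X Y Z =
     a 0 *\<^sub>R Riem M g p X Y Z
     + (a 1 * Ric M g p Y Z) *\<^sub>R X
     + (a 2 * Ric M g p X Z) *\<^sub>R Y
     + (a 3 * Ric M g p X Y) *\<^sub>R Z
     + (a 4 * g p Y Z) *\<^sub>R RicOp M g p X
     + (a 5 * g p X Z) *\<^sub>R RicOp M g p Y
     + (a 6 * g p X Y) *\<^sub>R RicOp M g p Z
     + (a 7 * scal M g p) *\<^sub>R (g p Y Z *\<^sub>R X - g p X Z *\<^sub>R Y)"

definition Ta_Ricci_semisymmetric ::
  "(nat \<Rightarrow> real) \<Rightarrow> ('p, 'n::finite) mfd \<Rightarrow> ('p, 'n) metric \<Rightarrow> bool" where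
  "Ta_Ricci_semisymmetric a M g \<longleftrightarrow> (\<forall>p\<in>carrier M. \<forall>X Y U V.
     Ric M g p (Ta a M g p X Y U) V + Ric M g p U (Ta a M g p X Y V) = 0)"


section \<open>Nullity distribution\<close>

definition nullity :: "('p, 'n::finite) mfd \<Rightarrow> ('p, 'n) metric \<Rightarrow> real \<Rightarrow> 'p \<Rightarrow> (real^'n) set" where
  "nullity M g k p = {Z. \<forall>X Y. Riem M g p X Y Z = k *\<^sub>R (g p Y Z *\<^sub>R X - g p X Z *\<^sub>R Y)}"

definition nullity_manifold ::
  "('p::{t2_space, second_countable_topology}, 'n::finite) mfd \<Rightarrow> ('p, 'n) metric
    \<Rightarrow> real \<Rightarrow> ('p \<Rightarrow> real^'n) \<Rightarrow> real \<Rightarrow> bool" where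
  "nullity_manifold M g k \<xi> \<epsilon> \<longleftrightarrow>
     semi_riemannian M g \<and> smooth_vector_field M \<xi> \<and> (\<epsilon> = 1 \<or> \<epsilon> = -1) \<and>
     (\<forall>p\<in>carrier M. g p (\<xi> p) (\<xi> p) = \<epsilon> \<and> \<xi> p \<in> nullity M g k p)"

definition eta :: "('p, 'n) metric \<Rightarrow> ('p \<Rightarrow> real^'n::finite) \<Rightarrow> real \<Rightarrow> 'p \<Rightarrow> real^'n \<Rightarrow> real" where
  "eta g \<xi> \<epsilon> p X = \<epsilon> * g p X (\<xi> p)"

definition eta_Einstein :: "('p, 'n::finite) mfd \<Rightarrow> ('p, 'n) metric
    \<Rightarrow> ('p \<Rightarrow> real^'n) \<Rightarrow> real \<Rightarrow> bool" where
  "eta_Einstein M g \<xi> \<epsilon> \<longleftrightarrow> (\<exists>\<alpha> \<beta>. smooth_function M \<alpha> \<and> smooth_function M \<beta> \<and>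
     (\<forall>p\<in>carrier M. \<forall>X Y.
        Ric M g p X Y = \<alpha> p * g p X Y + \<beta> p * (eta g \<xi> \<epsilon> p X * eta g \<xi> \<epsilon> p Y)))"

end

theory Submission
  imports Defs
begin

text \<open>Write $S$ for the Ricci tensor, $Q$ for the Ricci operator and $c = k(n-1)$. Taking the trace of
  $R(X,Y)\xi = k(g(Y,\xi)X - g(X,\xi)Y)$ over \<open>X\<close> gives $S(Y,\xi) = c\,g(Y,\xi)$, hence $Q\xi = c\,\xi$
  because $S$ is symmetric; the pair symmetry of the curvature gives
  $g(R(\xi,X)Y,\xi) = k(\varepsilon g(X,Y) - g(X,\xi)g(Y,\xi))$. Evaluating the semisymmetry condition
  $S(\mathcal{T}_a(\xi,X)Y,\xi) + S(Y,\mathcal{T}_a(\xi,X)\xi) = 0$ with these formulas yields the stated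
  identity (\<open>semisymmetric_identity\<close>). Apart from the nullity condition, the only facts about the
  curvature that enter are its pair symmetry and the symmetry of $S$; as the curvature is defined by
  coordinate formulas, both are derived from the compatibility of the Christoffel symbols with the
  metric and from the symmetry of second partial derivatives (\<open>pd_commute\<close>, \<open>curv_pair_sym\<close>, \<open>ricci_sym\<close>).

  If $a_5 = 0$ and $E$ has no zeros, the identity can be solved for $S$, with coefficients
  $\alpha = -F/E$ and $\beta = -G/E$. These have to be smooth functions on the manifold, and they involve
  the scalar curvature. Its value at a point is defined through the preferred chart at that point,
  whereas smoothness is tested in a fixed chart; hence the scalar curvature must be shown to be
  independent of the chart. This is the tensoriality of the curvature (\<open>curv_pull\<close>), obtained by
  differentiating the transformation law of the Christoffel symbols (\<open>chris2_pull\<close>). In a fixed chart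
  the scalar curvature is a rational expression in the metric components and their partial
  derivatives, hence smooth (\<open>smooth_scalar\<close>, \<open>smooth_function_scal\<close>).\<close>

section \<open>Calculus of partial derivatives\<close>

lemma pd_eqI:
  assumes "(f has_derivative f') (at x)"
  shows "pd i f x = f' (axis i 1)"
  unfolding pd_def using frechet_derivative_at[OF assms] by simp

lemma has_derivative_pd:
  assumes "f differentiable (at x)"
  shows "(f has_derivative (\<lambda>h. \<Sum>i\<in>UNIV. h $ i * pd i f x)) (at x)"
proof -
  have d: "(f has_derivative frechet_derivative f (at x)) (at x)"
    using assms frechet_derivative_works by blast
  have lin: "linear (frechet_derivative f (at x))"
    using d has_derivative_linear by blast
  have "frechet_derivative f (at x) h = (\<Sum>i\<in>UNIV. h $ i * pd i f x)" for h
  proof -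
    have "h = (\<Sum>i\<in>UNIV. h $ i *\<^sub>R axis i 1)"
      using basis_expansion[of h] by (simp add: scalar_mult_eq_scaleR)
    then have "frechet_derivative f (at x) h
        = frechet_derivative f (at x) (\<Sum>i\<in>UNIV. h $ i *\<^sub>R axis i 1)" by simp
    also have "\<dots> = (\<Sum>i\<in>UNIV. h $ i * pd i f x)"
      by (simp add: linear_sum[OF lin] linear_cmul[OF lin] pd_def)
    finally show ?thesis .
  qed
  then have "frechet_derivative f (at x) = (\<lambda>h. \<Sum>i\<in>UNIV. h $ i * pd i f x)" by blast
  with d show ?thesis by simp
qed

lemma pd_const: "pd i (\<lambda>x. c) x = 0"
  using pd_eqI[OF has_derivative_const] by blast

lemma pd_add:
  assumes "f differentiable (at x)" "g differentiable (at x)"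
  shows "pd i (\<lambda>x. f x + g x) x = pd i f x + pd i g x"
  unfolding pd_def frechet_derivative_at[OF has_derivative_add[OF
    assms[unfolded frechet_derivative_works]], symmetric] ..

lemma pd_mult:
  assumes "f differentiable (at x)" "g differentiable (at x)"
  shows "pd i (\<lambda>x. f x * g x) x = pd i f x * g x + f x * pd i g x"
  using pd_eqI[OF has_derivative_mult[OF assms[unfolded frechet_derivative_works]], where i = i]
  by (simp add: pd_def)

lemma pd_sum:
  assumes "\<And>a. a \<in> A \<Longrightarrow> f a differentiable (at x)"
  shows "pd i (\<lambda>x. \<Sum>a\<in>A. f a x) x = (\<Sum>a\<in>A. pd i (f a) x)"
  using pd_eqI[OF has_derivative_sum[of A f "\<lambda>a. frechet_derivative (f a) (at x)"], where i = i]
    assms[unfolded frechet_derivative_works]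
  by (simp add: pd_def)

lemma pd_inverse:
  assumes "f differentiable (at x)" "f x \<noteq> 0"
  shows "pd i (\<lambda>x. inverse (f x)) x = - (inverse (f x) * pd i f x * inverse (f x))"
  using pd_eqI[OF Deriv.has_derivative_inverse[OF assms(2) assms(1)[unfolded frechet_derivative_works]], where i = i]
  by (simp add: pd_def)

lemma pd_cong:
  assumes "open U" "x \<in> U" "\<And>y. y \<in> U \<Longrightarrow> f y = g y"
  shows "pd i f x = pd i g x"
proof (cases "f differentiable (at x)")
  case True
  then show ?thesis
    unfolding pd_def using frechet_derivative_transform_within_open[OF True assms] by simp
next
  case False
  have *: "(f has_derivative F) (at x) \<longleftrightarrow> (g has_derivative F) (at x)" for F
    using has_derivative_transform_within_open[OF _ assms(1,2)] assms(3) by metis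
  then show ?thesis unfolding pd_def frechet_derivative_def by simp
qed

lemma pd_component:
  fixes \<phi> :: "real^'n::finite \<Rightarrow> real^'m::finite"
  assumes "\<phi> differentiable (at x)"
  shows "pd i (\<lambda>x. \<phi> x $ a) x = frechet_derivative \<phi> (at x) (axis i 1) $ a"
proof -
  have d: "(\<phi> has_derivative frechet_derivative \<phi> (at x)) (at x)"
    using assms frechet_derivative_works by blast
  have "((\<lambda>x. \<phi> x $ a) has_derivative (\<lambda>h. frechet_derivative \<phi> (at x) h $ a)) (at x)"
    by (rule has_derivative_compose[OF d, of "\<lambda>v. v $ a" "\<lambda>v. v $ a", unfolded o_def])
       (rule bounded_linear_imp_has_derivative, rule bounded_linear_vec_nth)
  then show ?thesis by (rule pd_eqI)
qed

lemma pd_chain: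
  fixes \<phi> :: "real^'n::finite \<Rightarrow> real^'m::finite"
  assumes "f differentiable (at (\<phi> x))" "\<phi> differentiable (at x)"
  shows "pd i (\<lambda>x. f (\<phi> x)) x = (\<Sum>a\<in>UNIV. pd a f (\<phi> x) * pd i (\<lambda>x. \<phi> x $ a) x)"
  using has_derivative_compose[OF assms(2)[unfolded frechet_derivative_works] has_derivative_pd[OF assms(1)]]
  by (simp add: o_def pd_eqI pd_component[OF assms(2)] mult.commute)

section \<open>Algebra of smooth functions\<close>

lemma Ck_on_cong:
  assumes "open U" "\<And>x. x \<in> U \<Longrightarrow> f x = g x"
  shows "Ck_on k U f \<longleftrightarrow> Ck_on k U g"
  using assms(2)
proof (induction k arbitrary: f g)
  case 0
  then show ?case using continuous_on_cong by simp
next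
  case (Suc k)
  have "f differentiable (at x) \<longleftrightarrow> g differentiable (at x)" if "x \<in> U" for x
    unfolding differentiable_def
    using has_derivative_transform_within_open[OF _ assms(1) that] Suc.prems by metis
  moreover have "Ck_on k U (pd i f) \<longleftrightarrow> Ck_on k U (pd i g)" for i
    by (rule Suc.IH) (use pd_cong[OF assms(1)] Suc.prems in blast)
  ultimately show ?case by simp
qed

lemma smooth_on_cong:
  assumes "open U" "\<And>x. x \<in> U \<Longrightarrow> f x = g x"
  shows "smooth_on U f \<longleftrightarrow> smooth_on U g"
  proof -
  have "Ck_on k U f \<longleftrightarrow> Ck_on k U g" for k
    by (rule Ck_on_cong) (use assms in auto)
  then show ?thesis unfolding smooth_on_def by blast
qed

lemma Ck_on_Suc_imp: "Ck_on (Suc k) U f \<Longrightarrow> Ck_on k U f"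
proof (induction k arbitrary: f)
  case 0
  then show ?case
    by (auto intro!: continuous_at_imp_continuous_on differentiable_imp_continuous_within)
next
  case (Suc k)
  then show ?case by (metis Ck_on.simps(2))
qed

lemma Ck_on_subset: "Ck_on k U f \<Longrightarrow> V \<subseteq> U \<Longrightarrow> Ck_on k V f"
  by (induction k arbitrary: f) (auto intro: continuous_on_subset)

lemma smooth_on_subset: "smooth_on U f \<Longrightarrow> V \<subseteq> U \<Longrightarrow> smooth_on V f"
  unfolding smooth_on_def using Ck_on_subset by blast

lemma smooth_on_differentiable: "smooth_on U f \<Longrightarrow> x \<in> U \<Longrightarrow> f differentiable (at x)"
  unfolding smooth_on_def by (metis Ck_on.simps(2))

lemma smooth_on_pd: "smooth_on U f \<Longrightarrow> smooth_on U (pd i f)"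
  unfolding smooth_on_def by (metis Ck_on.simps(2))

lemma Ck_on_const:
  fixes U :: "(real^'n::finite) set"
  shows "Ck_on k U (\<lambda>x. c)"
proof (induction k arbitrary: c)
  case (Suc k)
  have "pd i (\<lambda>x. c) = (\<lambda>x. 0)" for i :: 'n using pd_const by blast
  with Suc show ?case by simp
qed simp

lemma Ck_on_add:
  assumes "open U" "Ck_on k U f" "Ck_on k U g"
  shows "Ck_on k U (\<lambda>x. f x + g x)"
  using assms(2,3)
proof (induction k arbitrary: f g)
  case 0
  then show ?case by (simp add: continuous_on_add)
next
  case (Suc k)
  have "Ck_on k U (pd i (\<lambda>x. f x + g x))" for i
  proof -
    have "Ck_on k U (\<lambda>x. pd i f x + pd i g x)" using Suc by simp
    then show ?thesis
      using Ck_on_cong[OF assms(1), of "pd i (\<lambda>x. f x + g x)"] Suc.prems by (simp add: pd_add)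
  qed
  then show ?case using Suc.prems by (simp add: differentiable_add)
qed

lemma Ck_on_mult:
  assumes "open U" "Ck_on k U f" "Ck_on k U g"
  shows "Ck_on k U (\<lambda>x. f x * g x)"
  using assms(2,3)
proof (induction k arbitrary: f g)
  case 0
  then show ?case by (simp add: continuous_on_mult)
next
  case (Suc k)
  have "Ck_on k U (pd i (\<lambda>x. f x * g x))" for i
  proof -
    have "Ck_on k U (\<lambda>x. pd i f x * g x)" "Ck_on k U (\<lambda>x. f x * pd i g x)"
      using Suc.IH Suc.prems Ck_on_Suc_imp by (metis Ck_on.simps(2))+
    then have "Ck_on k U (\<lambda>x. pd i f x * g x + f x * pd i g x)"
      using Ck_on_add[OF assms(1)] by blast
    then show ?thesis
      using Ck_on_cong[OF assms(1), of "pd i (\<lambda>x. f x * g x)"] Suc.prems by (simp add: pd_mult)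
  qed
  then show ?case using Suc.prems by (simp add: differentiable_mult)
qed

lemma Ck_on_inverse:
  assumes "open U" "Ck_on k U f" "\<And>x. x \<in> U \<Longrightarrow> f x \<noteq> 0"
  shows "Ck_on k U (\<lambda>x. inverse (f x))"
  using assms(2)
proof (induction k)
  case 0
  then show ?case using assms(3) by (simp add: continuous_on_inverse)
next
  case (Suc k)
  have "Ck_on k U (pd i (\<lambda>x. inverse (f x)))" for i
  proof -
    have inv: "Ck_on k U (\<lambda>x. inverse (f x))" using Suc Ck_on_Suc_imp by blast
    have "Ck_on k U (pd i f)" using Suc.prems by simp
    then have "Ck_on k U (\<lambda>x. - 1 * (inverse (f x) * pd i f x * inverse (f x)))"
      by (intro Ck_on_mult Ck_on_const assms(1) inv)
    then show ?thesis
      using Ck_on_cong[OF assms(1), of "pd i (\<lambda>x. inverse (f x))"] Suc.prems assms(3)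
      by (simp add: pd_inverse)
  qed
  then show ?case using Suc.prems assms(3) by (simp add: differentiable_inverse)
qed

lemma smooth_on_const: "smooth_on U (\<lambda>x. c)"
  unfolding smooth_on_def using Ck_on_const by blast

lemma smooth_on_add:
  "open U \<Longrightarrow> smooth_on U f \<Longrightarrow> smooth_on U g \<Longrightarrow> smooth_on U (\<lambda>x. f x + g x)"
  unfolding smooth_on_def using Ck_on_add by blast

lemma smooth_on_mult:
  "open U \<Longrightarrow> smooth_on U f \<Longrightarrow> smooth_on U g \<Longrightarrow> smooth_on U (\<lambda>x. f x * g x)"
  unfolding smooth_on_def using Ck_on_mult by blast

lemma smooth_on_diff:
  assumes "open U" "smooth_on U f" "smooth_on U g"
  shows "smooth_on U (\<lambda>x. f x - g x)"
  using smooth_on_add[OF assms(1,2) smooth_on_mult[OF assms(1) smooth_on_const[of U "-1"] assms(3)]]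
  by simp

lemma smooth_on_divide:
  assumes "open U" "smooth_on U f" "smooth_on U g" "\<And>x. x \<in> U \<Longrightarrow> g x \<noteq> 0"
  shows "smooth_on U (\<lambda>x. f x / g x)"
proof -
  have "smooth_on U (\<lambda>x. inverse (g x))"
    using assms unfolding smooth_on_def using Ck_on_inverse by blast
  then show ?thesis using smooth_on_mult[OF assms(1,2)] by (simp add: divide_inverse)
qed

lemma smooth_on_sum:
  assumes "open U" "\<And>a. a \<in> A \<Longrightarrow> smooth_on U (f a)"
  shows "smooth_on U (\<lambda>x. \<Sum>a\<in>A. f a x)"
  using assms(2) by (induction A rule: infinite_finite_induct)
    (auto intro: smooth_on_const smooth_on_add[OF assms(1)])

lemma smooth_on_prod:
  assumes "open U" "\<And>a. a \<in> A \<Longrightarrow> smooth_on U (f a)"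
  shows "smooth_on U (\<lambda>x. \<Prod>a\<in>A. f a x)"
  using assms(2) by (induction A rule: infinite_finite_induct)
    (auto intro: smooth_on_const smooth_on_mult[OF assms(1)])

lemma smooth_on_det:
  fixes A :: "'m::finite \<Rightarrow> 'm \<Rightarrow> real^'n::finite \<Rightarrow> real"
  assumes "open U" "\<And>i j. smooth_on U (A i j)"
  shows "smooth_on U (\<lambda>x. det (\<chi> i j. A i j x))"
  unfolding det_def
  by (simp, intro smooth_on_sum smooth_on_mult smooth_on_const smooth_on_prod assms)

lemma matrix_inv_right:
  fixes A :: "real^'m^'m" assumes "invertible A" shows "A ** matrix_inv A = mat 1"
  using assms unfolding invertible_def matrix_inv_def by (metis (mono_tags, lifting) someI_ex)

lemma matrix_inv_left:
  fixes A :: "real^'m^'m" assumes "invertible A" shows "matrix_inv A ** A = mat 1"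
  using matrix_inv_right[OF assms] matrix_left_right_inverse by blast

lemma invertible_cancel:
  fixes A :: "real^'m^'m"
  assumes "invertible A" "A *v v = A *v w"
  shows "v = w"
proof -
  have "matrix_inv A *v (A *v v) = matrix_inv A *v (A *v w)" using assms(2) by simp
  then show ?thesis by (simp add: matrix_vector_mul_assoc matrix_inv_left[OF assms(1)])
qed

text \<open>Smoothness of the inverse matrix comes from Cramer's rule.\<close>

lemma smooth_on_matrix_inv:
  fixes A :: "'m::finite \<Rightarrow> 'm \<Rightarrow> real^'n::finite \<Rightarrow> real"
  assumes "open U" "\<And>i j. smooth_on U (A i j)" "\<And>x. x \<in> U \<Longrightarrow> invertible (\<chi> i j. A i j x)"
  shows "smooth_on U (\<lambda>x. matrix_inv (\<chi> i j. A i j x) $ l $ m)"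
proof -
  define B where "B = (\<lambda>i j x. if j = l then (axis m 1 :: real^'m) $ i else A i j x)"
  have "smooth_on U (B i j)" for i j
    by (cases "j = l") (simp_all add: B_def smooth_on_const assms(2))
  then have "smooth_on U (\<lambda>x. det (\<chi> i j. B i j x) / det (\<chi> i j. A i j x))"
    by (intro smooth_on_divide smooth_on_det assms(1,2)) (use assms(3) invertible_det_nz in blast)+
  moreover have "det (\<chi> i j. B i j x) / det (\<chi> i j. A i j x)
      = matrix_inv (\<chi> i j. A i j x) $ l $ m" if "x \<in> U" for x
  proof -
    let ?A = "\<chi> i j. A i j x"
    have "det ?A \<noteq> 0" using assms(3)[OF that] invertible_det_nz by blast
    moreover have "?A *v (matrix_inv ?A *v axis m 1) = axis m 1"
      by (simp add: matrix_vector_mul_assoc matrix_inv_right[OF assms(3)[OF that]])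
    ultimately have "(matrix_inv ?A *v axis m 1) $ l
        = det (\<chi> i j. if j = l then (axis m 1 :: real^'m) $ i else ?A $ i $ j) / det ?A"
      using cramer[of ?A "matrix_inv ?A *v axis m 1" "axis m 1"] by simp
    then show ?thesis by (simp add: B_def matrix_vector_mul_component inner_axis cong: if_cong)
  qed
  ultimately show ?thesis
    using smooth_on_cong[OF assms(1)] by (metis (no_types, lifting))
qed

section \<open>Symmetry of second partial derivatives\<close>

lemma has_real_derivative_line:
  assumes "f differentiable (at (p + t *\<^sub>R axis i 1))"
  shows "((\<lambda>t. f (p + t *\<^sub>R axis i 1)) has_real_derivative pd i f (p + t *\<^sub>R axis i 1)) (at t)"
proof -
  have "((\<lambda>t. p + t *\<^sub>R axis i (1::real)) has_derivative (\<lambda>t. t *\<^sub>R axis i 1)) (at t)"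
    by (auto intro!: derivative_eq_intros)
  from has_derivative_compose[OF this has_derivative_pd[OF assms]]
  have "((\<lambda>t. f (p + t *\<^sub>R axis i 1)) has_derivative
      (\<lambda>s. \<Sum>j\<in>UNIV. (s *\<^sub>R axis i 1) $ j * pd j f (p + t *\<^sub>R axis i 1))) (at t)" .
  also have "(\<lambda>s. \<Sum>j\<in>UNIV. (s *\<^sub>R axis i (1::real)) $ j * pd j f (p + t *\<^sub>R axis i 1))
      = (\<lambda>s. pd i f (p + t *\<^sub>R axis i 1) * s)"
    by (simp add: axis_def if_distrib[of "\<lambda>u. u * _"] if_distrib[of "\<lambda>u. _ * u"] sum.delta fun_eq_iff mult.commute cong: if_cong)
  finally show ?thesis unfolding has_field_derivative_def .
qed

text \<open>The second difference of \<open>f\<close> over a small parallelogram is symmetric in the two directions, and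
  two applications of the mean value theorem express it by a mixed second derivative.\<close>

lemma second_difference_mvt:
  fixes f :: "real^'n::finite \<Rightarrow> real"
  assumes f: "\<And>y. y \<in> U \<Longrightarrow> f differentiable (at y)"
    and f': "\<And>y. y \<in> U \<Longrightarrow> pd i f differentiable (at y)"
    and h: "0 < h" and U: "ball x (3 * h) \<subseteq> U"
  shows "\<exists>y\<in>ball x (3 * h). f (x + h *\<^sub>R axis i 1 + h *\<^sub>R axis j 1) - f (x + h *\<^sub>R axis i 1)
      - f (x + h *\<^sub>R axis j 1) + f x = h * h * pd j (pd i f) y"
proof -
  let ?e = "axis i 1 :: real^'n" and ?d = "axis j 1 :: real^'n"
  have near: "x + s *\<^sub>R ?e + t *\<^sub>R ?d \<in> ball x (3 * h)" if "0 \<le> s" "s \<le> h" "0 \<le> t" "t \<le> h" for s t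
  proof -
    have "norm (s *\<^sub>R ?e + t *\<^sub>R ?d) \<le> norm (s *\<^sub>R ?e) + norm (t *\<^sub>R ?d)" by (rule norm_triangle_ineq)
    also have "\<dots> < 3 * h" using that h by simp
    finally have "norm (s *\<^sub>R ?e + t *\<^sub>R ?d) < 3 * h" .
    moreover have "dist x (x + s *\<^sub>R ?e + t *\<^sub>R ?d) = norm (s *\<^sub>R ?e + t *\<^sub>R ?d)"
      by (metis add.assoc add_diff_cancel_left' dist_commute dist_norm)
    ultimately show ?thesis by simp
  qed
  note near0 = near[where t = 0, simplified]
  let ?F = "\<lambda>t. f ((x + h *\<^sub>R ?d) + t *\<^sub>R ?e) - f (x + t *\<^sub>R ?e)"
  let ?F' = "\<lambda>t. pd i f ((x + h *\<^sub>R ?d) + t *\<^sub>R ?e) - pd i f (x + t *\<^sub>R ?e)"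
  have "(?F has_real_derivative ?F' t) (at t)" if "0 \<le> t" "t \<le> h" for t
    by (intro DERIV_diff has_real_derivative_line f subsetD[OF U])
      (use near[of t h] near0[of t] that h in \<open>simp_all add: add_ac\<close>)
  then obtain s where s: "0 < s" "s < h" "?F h - ?F 0 = (h - 0) * ?F' s"
    using MVT2[OF h, of ?F ?F'] by blast
  let ?H = "\<lambda>t. pd i f ((x + s *\<^sub>R ?e) + t *\<^sub>R ?d)"
  let ?H' = "\<lambda>t. pd j (pd i f) ((x + s *\<^sub>R ?e) + t *\<^sub>R ?d)"
  have "(?H has_real_derivative ?H' t) (at t)" if "0 \<le> t" "t \<le> h" for t
    by (intro has_real_derivative_line f' subsetD[OF U]) (use near[of s t] s that in simp)
  then obtain t where t: "0 < t" "t < h" "?H h - ?H 0 = (h - 0) * ?H' t"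
    using MVT2[OF h, of ?H ?H'] by blast
  have "?F' s = h * ?H' t" using t(3) by (simp add: add_ac)
  then have "?F h - ?F 0 = h * h * ?H' t" using s(3) by (simp add: mult.assoc)
  then show ?thesis
    by (intro bexI[of _ "x + s *\<^sub>R ?e + t *\<^sub>R ?d"] near) (use s t in \<open>simp_all add: algebra_simps\<close>)
qed

lemma pd_commute:
  assumes "open U" "smooth_on U f" "x \<in> U"
  shows "pd i (pd j f) x = pd j (pd i f) x"
proof (rule ccontr)
  assume ne: "pd i (pd j f) x \<noteq> pd j (pd i f) x"
  define e where "e = \<bar>pd i (pd j f) x - pd j (pd i f) x\<bar> / 2"
  have e: "e > 0" using ne by (simp add: e_def)
  have cont: "continuous (at x) (pd a (pd b f))" for a b
    by (intro differentiable_imp_continuous_within smooth_on_differentiable[OF _ assms(3)]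
        smooth_on_pd assms(2))
  obtain d1 where d1: "d1 > 0" "\<And>y. dist y x < d1 \<Longrightarrow> dist (pd i (pd j f) y) (pd i (pd j f) x) < e"
    using cont[of i j] e unfolding continuous_at_eps_delta by metis
  obtain d2 where d2: "d2 > 0" "\<And>y. dist y x < d2 \<Longrightarrow> dist (pd j (pd i f) y) (pd j (pd i f) x) < e"
    using cont[of j i] e unfolding continuous_at_eps_delta by metis
  obtain d3 where d3: "d3 > 0" "ball x d3 \<subseteq> U" using assms(1,3) open_contains_ball by blast
  define h where "h = min d1 (min d2 d3) / 3"
  have h: "h > 0" "3 * h \<le> d1" "3 * h \<le> d2" "3 * h \<le> d3" using d1 d2 d3 by (auto simp: h_def)
  have U: "ball x (3 * h) \<subseteq> U" using d3(2) h(4) subset_ball by fastforce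
  have f: "\<And>y. y \<in> U \<Longrightarrow> f differentiable (at y)" "\<And>a y. y \<in> U \<Longrightarrow> pd a f differentiable (at y)"
    using smooth_on_differentiable assms(2) smooth_on_pd by blast+
  obtain y where y: "y \<in> ball x (3 * h)" "f (x + h *\<^sub>R axis i 1 + h *\<^sub>R axis j 1) - f (x + h *\<^sub>R axis i 1)
      - f (x + h *\<^sub>R axis j 1) + f x = h * h * pd j (pd i f) y"
    using second_difference_mvt[OF f h(1) U] by blast
  obtain z where z: "z \<in> ball x (3 * h)" "f (x + h *\<^sub>R axis j 1 + h *\<^sub>R axis i 1) - f (x + h *\<^sub>R axis j 1)
      - f (x + h *\<^sub>R axis i 1) + f x = h * h * pd i (pd j f) z"
    using second_difference_mvt[OF f h(1) U] by blast
  have "h * h * pd j (pd i f) y = h * h * pd i (pd j f) z"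
    using y(2) z(2) unfolding add.commute[of "h *\<^sub>R axis j 1" "h *\<^sub>R axis i 1"] add.assoc by linarith
  then have eq: "pd j (pd i f) y = pd i (pd j f) z" using h(1) by simp
  have "dist (pd i (pd j f) z) (pd i (pd j f) x) < e"
    by (rule d1(2)) (use z(1) h in \<open>simp add: dist_commute\<close>)
  moreover have "dist (pd j (pd i f) y) (pd j (pd i f) x) < e"
    by (rule d2(2)) (use y(1) h in \<open>simp add: dist_commute\<close>)
  ultimately show False using eq unfolding e_def dist_real_def by argo
qed

section \<open>Christoffel symbols and curvature in coordinates\<close>

text \<open>In this section \<open>G i j\<close> are the components of a metric on an open set of $\mathbb{R}^n$, detached
  from any manifold, so that two metrics related by a change of coordinates can be compared.
  The Christoffel symbols of the first kind: \<open>chris1 G m i j\<close> is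
  $\Gamma_{m,ij} = \frac12(\partial_i G_{jm} + \partial_j G_{im} - \partial_m G_{ij})$.\<close>

definition chris1 :: "('n \<Rightarrow> 'n \<Rightarrow> real^'n::finite \<Rightarrow> real) \<Rightarrow> 'n \<Rightarrow> 'n \<Rightarrow> 'n \<Rightarrow> real^'n \<Rightarrow> real" where
  "chris1 G m i j x = (pd i (G j m) x + pd j (G i m) x - pd m (G i j) x) / 2"

text \<open>The Christoffel symbols of the second kind: \<open>chris2 G l i j\<close> is
  $\Gamma^l_{ij} = G^{lm}\Gamma_{m,ij}$.\<close>

definition chris2 :: "('n \<Rightarrow> 'n \<Rightarrow> real^'n::finite \<Rightarrow> real) \<Rightarrow> 'n \<Rightarrow> 'n \<Rightarrow> 'n \<Rightarrow> real^'n \<Rightarrow> real" where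
  "chris2 G l i j x = (\<Sum>m\<in>UNIV. matrix_inv (\<chi> a b. G a b x) $ l $ m * chris1 G m i j x)"

text \<open>\<open>curv \<Gamma> l i j k\<close> is the \<open>l\<close>-th component of $R(\partial_i,\partial_j)\partial_k$ for the connection with
  coefficients \<open>\<Gamma>\<close>.\<close>

definition curv :: "('n \<Rightarrow> 'n \<Rightarrow> 'n \<Rightarrow> real^'n::finite \<Rightarrow> real)
    \<Rightarrow> 'n \<Rightarrow> 'n \<Rightarrow> 'n \<Rightarrow> 'n \<Rightarrow> real^'n \<Rightarrow> real" where
  "curv \<Gamma> l i j k x = pd i (\<Gamma> l j k) x - pd j (\<Gamma> l i k) x
     + (\<Sum>m\<in>UNIV. \<Gamma> l i m x * \<Gamma> m j k x - \<Gamma> l j m x * \<Gamma> m i k x)"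

lemma curv_antisym: "curv \<Gamma> l i j k x = - curv \<Gamma> l j i k x"
  by (simp add: curv_def sum_subtractf)

text \<open>A metric in coordinates: smooth components on an open set, forming an invertible symmetric
  matrix at each point.\<close>

locale local_metric =
  fixes U :: "(real^'n::finite) set" and G :: "'n \<Rightarrow> 'n \<Rightarrow> real^'n \<Rightarrow> real"
  assumes open_U: "open U"
    and smooth_G: "smooth_on U (G i j)"
    and sym_G: "x \<in> U \<Longrightarrow> G i j x = G j i x"
    and inv_G: "x \<in> U \<Longrightarrow> invertible (\<chi> i j. G i j x)"
begin

abbreviation "\<Gamma> \<equiv> chris2 G"

lemma diff_G: "x \<in> U \<Longrightarrow> G i j differentiable (at x)"
  using smooth_G smooth_on_differentiable by blast

lemma pd_G_sym: "x \<in> U \<Longrightarrow> pd m (G i j) x = pd m (G j i) x"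
  using pd_cong[OF open_U] sym_G by blast

lemma chris1_sym: "x \<in> U \<Longrightarrow> chris1 G m i j x = chris1 G m j i x"
  using pd_G_sym[of x m i j] by (simp add: chris1_def)

lemma chris2_sym: "x \<in> U \<Longrightarrow> \<Gamma> l i j x = \<Gamma> l j i x"
  unfolding chris2_def using chris1_sym by simp

lemma smooth_chris1: "smooth_on U (chris1 G m i j)"
  unfolding chris1_def[abs_def]
  by (intro smooth_on_divide smooth_on_add smooth_on_diff smooth_on_pd smooth_G open_U smooth_on_const) simp

lemma smooth_chris2: "smooth_on U (\<Gamma> l i j)"
  unfolding chris2_def[abs_def]
  by (intro smooth_on_sum smooth_on_mult smooth_on_matrix_inv smooth_chris1 smooth_G open_U inv_G)

lemma diff_chris2: "x \<in> U \<Longrightarrow> \<Gamma> l i j differentiable (at x)"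
  using smooth_chris2 smooth_on_differentiable by blast

lemma smooth_curv: "smooth_on U (curv \<Gamma> l i j k)"
  unfolding curv_def[abs_def]
  by (intro smooth_on_sum smooth_on_add smooth_on_diff smooth_on_mult smooth_on_pd smooth_chris2 open_U)

lemma lower_chris2:
  assumes "x \<in> U"
  shows "(\<Sum>l\<in>UNIV. G m l x * \<Gamma> l i j x) = chris1 G m i j x"
proof -
  let ?A = "\<chi> i j. G i j x" and ?v = "\<chi> m. chris1 G m i j x"
  have "(\<Sum>l\<in>UNIV. G m l x * \<Gamma> l i j x) = (?A *v (matrix_inv ?A *v ?v)) $ m"
    by (simp add: matrix_vector_mult_def chris2_def)
  then show ?thesis
    by (simp add: matrix_vector_mul_assoc matrix_inv_right[OF inv_G[OF assms]])
qed

text \<open>Compatibility of the Levi-Civita connection with the metric.\<close>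

lemma pd_metric:
  assumes "x \<in> U"
  shows "pd i (G j m) x = chris1 G j i m x + chris1 G m i j x"
  using pd_G_sym[OF assms, of i j m] pd_G_sym[OF assms, of m i j] pd_G_sym[OF assms, of j i m]
  by (simp add: chris1_def field_simps)

lemma pd_chris1:
  assumes "x \<in> U"
  shows "pd p (chris1 G m i j) x
    = (pd p (pd i (G j m)) x + pd p (pd j (G i m)) x - pd p (pd m (G i j)) x) / 2"
proof -
  have d: "pd i (G j m) differentiable (at x)" for i j m
    using smooth_on_differentiable[OF smooth_on_pd[OF smooth_G] assms] .
  have "((\<lambda>x. (pd i (G j m) x + pd j (G i m) x - pd m (G i j) x) / 2) has_derivative
     (\<lambda>h. (frechet_derivative (pd i (G j m)) (at x) h + frechet_derivative (pd j (G i m)) (at x) h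
        - frechet_derivative (pd m (G i j)) (at x) h) / 2)) (at x)"
    using d[unfolded frechet_derivative_works] by (auto intro!: derivative_eq_intros)
  then show ?thesis
    unfolding chris1_def[abs_def] by (subst pd_eqI, assumption) (simp add: pd_def)
qed

text \<open>The expression whose antisymmetrization in \<open>i\<close> and \<open>j\<close> is the curvature with lowered index; it is
  found by differentiating \<open>lower_chris2\<close> and using \<open>pd_metric\<close>.\<close>

lemma sum_pd_chris2:
  assumes "x \<in> U"
  shows "(\<Sum>l\<in>UNIV. G m l x * (pd i (\<Gamma> l j k) x + (\<Sum>p\<in>UNIV. \<Gamma> l i p x * \<Gamma> p j k x)))
    = pd i (chris1 G m j k) x - (\<Sum>p\<in>UNIV. chris1 G p i m x * \<Gamma> p j k x)"
proof -
  have "pd i (chris1 G m j k) x = pd i (\<lambda>x. \<Sum>l\<in>UNIV. G m l x * \<Gamma> l j k x) x"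
    using pd_cong[OF open_U assms] lower_chris2 by (metis (no_types, lifting))
  also have "\<dots> = (\<Sum>l\<in>UNIV. pd i (G m l) x * \<Gamma> l j k x + G m l x * pd i (\<Gamma> l j k) x)"
    by (subst pd_sum) (auto intro!: differentiable_mult sum.cong pd_mult diff_G diff_chris2 assms)
  also have "\<dots> = (\<Sum>l\<in>UNIV. chris1 G m i l x * \<Gamma> l j k x) + (\<Sum>l\<in>UNIV. chris1 G l i m x * \<Gamma> l j k x)
      + (\<Sum>l\<in>UNIV. G m l x * pd i (\<Gamma> l j k) x)"
    by (simp add: pd_metric[OF assms] sum.distrib distrib_right)
  also have "(\<Sum>l\<in>UNIV. chris1 G m i l x * \<Gamma> l j k x)
      = (\<Sum>p\<in>UNIV. \<Sum>l\<in>UNIV. G m l x * (\<Gamma> l i p x * \<Gamma> p j k x))"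
    by (simp add: lower_chris2[OF assms, symmetric] sum_distrib_right mult.assoc)
  also have "\<dots> = (\<Sum>l\<in>UNIV. G m l x * (\<Sum>p\<in>UNIV. \<Gamma> l i p x * \<Gamma> p j k x))"
    by (subst sum.swap) (simp add: sum_distrib_left)
  finally show ?thesis by (simp add: distrib_left sum.distrib)
qed

text \<open>The curvature with lowered first index: second derivatives of the metric, plus a quadratic
  expression in the Christoffel symbols.\<close>

lemma lower_curv:
  assumes "x \<in> U"
  shows "(\<Sum>l\<in>UNIV. G m l x * curv \<Gamma> l i j k x)
    = (pd i (pd k (G j m)) x - pd i (pd m (G j k)) x - pd j (pd k (G i m)) x + pd j (pd m (G i k)) x) / 2
      + (\<Sum>p\<in>UNIV. chris1 G p j m x * \<Gamma> p i k x) - (\<Sum>p\<in>UNIV. chris1 G p i m x * \<Gamma> p j k x)"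
proof -
  have "(\<Sum>l\<in>UNIV. G m l x * curv \<Gamma> l i j k x)
    = (\<Sum>l\<in>UNIV. G m l x * (pd i (\<Gamma> l j k) x + (\<Sum>p\<in>UNIV. \<Gamma> l i p x * \<Gamma> p j k x)))
    - (\<Sum>l\<in>UNIV. G m l x * (pd j (\<Gamma> l i k) x + (\<Sum>p\<in>UNIV. \<Gamma> l j p x * \<Gamma> p i k x)))"
    unfolding sum_subtractf[symmetric] right_diff_distrib[symmetric]
    by (simp add: curv_def sum_subtractf algebra_simps)
  then show ?thesis
    unfolding sum_pd_chris2[OF assms] pd_chris1[OF assms]
    using pd_commute[OF open_U smooth_G assms, of i j k m] by (simp add: field_simps)
qed

text \<open>The symmetry \<open>g(R(X,Y)Z,W) = g(R(Z,W)X,Y)\<close> of the curvature tensor.\<close>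

lemma curv_pair_sym:
  assumes "x \<in> U"
  shows "(\<Sum>l\<in>UNIV. G m l x * curv \<Gamma> l i j k x) = (\<Sum>l\<in>UNIV. G j l x * curv \<Gamma> l k m i x)"
proof -
  \<comment> \<open>Both sides are $G_{pl}\Gamma^l_{ab}\Gamma^p_{cd}$, and \<open>G\<close> is symmetric.\<close>
  have sw: "(\<Sum>p\<in>UNIV. chris1 G p a b x * \<Gamma> p c d x) = (\<Sum>p\<in>UNIV. chris1 G p c d x * \<Gamma> p a b x)"
    for a b c d
  proof -
    have "(\<Sum>p\<in>UNIV. chris1 G p a b x * \<Gamma> p c d x)
        = (\<Sum>p\<in>UNIV. \<Sum>l\<in>UNIV. G p l x * \<Gamma> l a b x * \<Gamma> p c d x)"
      by (simp add: lower_chris2[OF assms, symmetric] sum_distrib_right)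
    also have "\<dots> = (\<Sum>l\<in>UNIV. \<Sum>p\<in>UNIV. G l p x * \<Gamma> p c d x * \<Gamma> l a b x)"
      by (subst sum.swap) (simp add: sym_G[OF assms] mult_ac)
    also have "\<dots> = (\<Sum>p\<in>UNIV. chris1 G p c d x * \<Gamma> p a b x)"
      by (simp add: lower_chris2[OF assms, symmetric] sum_distrib_right)
    finally show ?thesis .
  qed
  have pds: "pd a (pd b (G c d)) x = pd a (pd b (G d c)) x" for a b c d
    by (rule pd_cong[OF open_U assms]) (rule pd_G_sym)
  show ?thesis
    unfolding lower_curv[OF assms]
    using sw[of i m j k] pd_commute[OF open_U smooth_G assms]
    by (simp add: chris1_sym[OF assms, of _ m j] chris1_sym[OF assms, of _ k j] chris2_sym[OF assms, of _ k i]
       chris2_sym[OF assms, of _ m i] chris1_sym[OF assms, of _ m i] pds[of _ _ k j] pds[of _ _ k i] pds[of _ _ m j] pds[of _ _ m i])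
qed

end

section \<open>Change of coordinates\<close>

lemma sum_rotate:
  "(\<Sum>a\<in>A. \<Sum>b\<in>B. \<Sum>c\<in>C. f a b c) = (\<Sum>b\<in>B. \<Sum>c\<in>C. \<Sum>a\<in>A. f a b c)"
proof -
  have "(\<Sum>a\<in>A. \<Sum>b\<in>B. \<Sum>c\<in>C. f a b c) = (\<Sum>b\<in>B. \<Sum>a\<in>A. \<Sum>c\<in>C. f a b c)" by (rule sum.swap)
  also have "\<dots> = (\<Sum>b\<in>B. \<Sum>c\<in>C. \<Sum>a\<in>A. f a b c)" by (intro sum.cong refl sum.swap)
  finally show ?thesis .
qed

lemma pd_sum_sum:
  assumes "\<And>a b. f a b differentiable (at x)"
  shows "pd i (\<lambda>x. \<Sum>a\<in>(UNIV::'a::finite set). \<Sum>b\<in>(UNIV::'b::finite set). f a b x) x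
    = (\<Sum>a\<in>UNIV. \<Sum>b\<in>UNIV. pd i (f a b) x)"
proof -
  have "(\<lambda>x. \<Sum>b\<in>UNIV. f a b x) differentiable (at x)" for a
    using assms by (intro differentiable_sum) auto
  then show ?thesis by (simp add: pd_sum assms)
qed

text \<open>A change of coordinates \<open>\<phi>\<close> under which the metric \<open>G\<close> is the pullback of the metric \<open>G'\<close>.
  Only the invertibility of the Jacobian matters, so \<open>\<phi>\<close> need not be injective.\<close>

locale metric_change = L: local_metric U G + L': local_metric U' G'
  for U :: "(real^'n::finite) set" and G and U' :: "(real^'n) set" and G' +
  fixes \<phi> :: "real^'n \<Rightarrow> real^'n"
  assumes maps: "x \<in> U \<Longrightarrow> \<phi> x \<in> U'"
    and smooth_\<phi>: "smooth_on U (\<lambda>x. \<phi> x $ a)"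
    and inv_J: "x \<in> U \<Longrightarrow> invertible (\<chi> a i. pd i (\<lambda>x. \<phi> x $ a) x)"
    and pullback: "x \<in> U \<Longrightarrow> G i j x =
      (\<Sum>a\<in>UNIV. \<Sum>b\<in>UNIV. G' a b (\<phi> x) * pd i (\<lambda>x. \<phi> x $ a) x * pd j (\<lambda>x. \<phi> x $ b) x)"
begin

text \<open>First and second partial derivatives of \<open>\<phi>\<close>: \<open>J a i\<close> is $\partial_i\phi^a$ and \<open>H a i j\<close> is
  $\partial_i\partial_j\phi^a$.\<close>

abbreviation J :: "'n \<Rightarrow> 'n \<Rightarrow> real^'n \<Rightarrow> real" where "J a i \<equiv> pd i (\<lambda>x. \<phi> x $ a)"

abbreviation H :: "'n \<Rightarrow> 'n \<Rightarrow> 'n \<Rightarrow> real^'n \<Rightarrow> real" where "H a i j \<equiv> pd i (J a j)"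

abbreviation "\<Gamma> \<equiv> chris2 G"
abbreviation "\<Gamma>' \<equiv> chris2 G'"

lemma diff_\<phi>: "x \<in> U \<Longrightarrow> \<phi> differentiable (at x)"
  using smooth_on_differentiable[OF smooth_\<phi>]
  by (auto simp: differentiable_componentwise_within[of \<phi>] Basis_vec_def inner_axis)

lemma diff_J: "x \<in> U \<Longrightarrow> J a i differentiable (at x)"
  using smooth_on_differentiable smooth_on_pd smooth_\<phi> by blast

lemma diff_H: "x \<in> U \<Longrightarrow> H a i j differentiable (at x)"
  using smooth_on_differentiable smooth_on_pd smooth_\<phi> by blast

lemma H_sym: "x \<in> U \<Longrightarrow> H a i j x = H a j i x"
  using pd_commute[OF L.open_U smooth_\<phi>] .

lemma pd_pull:
  assumes "x \<in> U" "smooth_on U' f"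
  shows "pd i (\<lambda>x. f (\<phi> x)) x = (\<Sum>c\<in>UNIV. pd c f (\<phi> x) * J c i x)"
  by (rule pd_chain) (use assms maps smooth_on_differentiable diff_\<phi> in auto)

lemma diff_pull:
  assumes "x \<in> U" "smooth_on U' f"
  shows "(\<lambda>x. f (\<phi> x)) differentiable (at x)"
  using differentiable_chain_at[of \<phi> x f] assms maps smooth_on_differentiable diff_\<phi>
  by (auto simp: o_def)

lemma pd_G_pull:
  assumes x: "x \<in> U"
  shows "pd m (G i j) x =
      (\<Sum>a\<in>UNIV. \<Sum>b\<in>UNIV. \<Sum>c\<in>UNIV. pd c (G' a b) (\<phi> x) * J a i x * J b j x * J c m x)
    + (\<Sum>a\<in>UNIV. \<Sum>b\<in>UNIV. G' a b (\<phi> x) * H a m i x * J b j x)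
    + (\<Sum>a\<in>UNIV. \<Sum>b\<in>UNIV. G' a b (\<phi> x) * H a m j x * J b i x)"
proof -
  have dG: "(\<lambda>x. G' a b (\<phi> x)) differentiable (at x)" for a b
    by (rule diff_pull[OF x L'.smooth_G])
  have "pd m (G i j) x = pd m (\<lambda>x. \<Sum>a\<in>UNIV. \<Sum>b\<in>UNIV. G' a b (\<phi> x) * J a i x * J b j x) x"
    by (rule pd_cong[OF L.open_U x pullback])
  also have "\<dots> = (\<Sum>a\<in>UNIV. \<Sum>b\<in>UNIV. pd m (\<lambda>x. G' a b (\<phi> x) * J a i x * J b j x) x)"
    by (intro pd_sum_sum differentiable_mult dG diff_J x)
  also have "\<dots> = (\<Sum>a\<in>UNIV. \<Sum>b\<in>UNIV.
        (\<Sum>c\<in>UNIV. pd c (G' a b) (\<phi> x) * J c m x) * J a i x * J b j x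
      + G' a b (\<phi> x) * H a m i x * J b j x + G' a b (\<phi> x) * H b m j x * J a i x)"
    by (intro sum.cong refl)
      (simp add: pd_mult differentiable_mult dG diff_J x pd_pull[OF x L'.smooth_G] algebra_simps)
  also have "\<dots> = (\<Sum>a\<in>UNIV. \<Sum>b\<in>UNIV. \<Sum>c\<in>UNIV. pd c (G' a b) (\<phi> x) * J a i x * J b j x * J c m x)
    + (\<Sum>a\<in>UNIV. \<Sum>b\<in>UNIV. G' a b (\<phi> x) * H a m i x * J b j x)
    + (\<Sum>a\<in>UNIV. \<Sum>b\<in>UNIV. G' a b (\<phi> x) * H b m j x * J a i x)"
    by (simp add: sum.distrib sum_distrib_right sum_distrib_left mult_ac)
  also have "(\<Sum>a\<in>UNIV. \<Sum>b\<in>UNIV. G' a b (\<phi> x) * H b m j x * J a i x)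
      = (\<Sum>a\<in>UNIV. \<Sum>b\<in>UNIV. G' a b (\<phi> x) * H a m j x * J b i x)"
    by (subst sum.swap) (simp add: L'.sym_G[OF maps[OF x]])
  finally show ?thesis .
qed

lemma chris1_pull:
  assumes x: "x \<in> U"
  shows "chris1 G m i j x =
      (\<Sum>c\<in>UNIV. \<Sum>a\<in>UNIV. \<Sum>b\<in>UNIV. chris1 G' c a b (\<phi> x) * J a i x * J b j x * J c m x)
    + (\<Sum>a\<in>UNIV. \<Sum>b\<in>UNIV. G' a b (\<phi> x) * H a i j x * J b m x)"
proof -
  define P where "P i j m = (\<Sum>a\<in>UNIV. \<Sum>b\<in>UNIV. \<Sum>c\<in>UNIV. pd c (G' a b) (\<phi> x) * J a i x * J b j x * J c m x)"
    for i j m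
  define Q where "Q i j m = (\<Sum>a\<in>UNIV. \<Sum>b\<in>UNIV. G' a b (\<phi> x) * H a i j x * J b m x)" for i j m
  have Qs: "Q i j m = Q j i m" for i j m unfolding Q_def by (simp add: H_sym[OF x])
  have pd: "pd m (G i j) x = P i j m + Q m i j + Q m j i" for i j m
    unfolding pd_G_pull[OF x] P_def Q_def by simp
  have 1: "P j m i = (\<Sum>c\<in>UNIV. \<Sum>a\<in>UNIV. \<Sum>b\<in>UNIV. pd a (G' b c) (\<phi> x) * J a i x * J b j x * J c m x)"
    unfolding P_def by (subst sum_rotate) (simp add: mult_ac)
  have 2: "P i m j = (\<Sum>c\<in>UNIV. \<Sum>a\<in>UNIV. \<Sum>b\<in>UNIV. pd b (G' a c) (\<phi> x) * J a i x * J b j x * J c m x)"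
    unfolding P_def by (subst sum.swap) (simp add: mult_ac)
  have 3: "P i j m = (\<Sum>c\<in>UNIV. \<Sum>a\<in>UNIV. \<Sum>b\<in>UNIV. pd c (G' a b) (\<phi> x) * J a i x * J b j x * J c m x)"
    unfolding P_def by (subst sum_rotate[symmetric]) simp
  have "chris1 G m i j x = (P j m i + P i m j - P i j m) / 2 + Q i j m"
    unfolding chris1_def pd using Qs[of i m j] Qs[of j m i] Qs[of i j m] by (simp add: field_simps)
  also have "(P j m i + P i m j - P i j m) / 2
      = (\<Sum>c\<in>UNIV. \<Sum>a\<in>UNIV. \<Sum>b\<in>UNIV. chris1 G' c a b (\<phi> x) * J a i x * J b j x * J c m x)"
    unfolding 1 2 3 sum.distrib[symmetric] sum_subtractf[symmetric] sum_divide_distrib chris1_def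
    by (intro sum.cong refl) (simp add: field_simps)
  finally show ?thesis unfolding Q_def .
qed

lemma nondegenerate_pull:
  assumes x: "x \<in> U"
    and eq: "\<And>m. (\<Sum>c\<in>UNIV. J c m x * (\<Sum>d\<in>UNIV. G' c d (\<phi> x) * v d))
              = (\<Sum>c\<in>UNIV. J c m x * (\<Sum>d\<in>UNIV. G' c d (\<phi> x) * w d))"
  shows "v a = w a"
proof -
  let ?J = "\<chi> a i. J a i x" and ?G = "\<chi> c d. G' c d (\<phi> x)"
  have inv: "invertible (transpose ?J ** ?G)"
    by (intro invertible_mult transpose_invertible inv_J[OF x] L'.inv_G maps[OF x])
  have "(transpose ?J ** ?G) *v (\<chi> d. v d) = (transpose ?J ** ?G) *v (\<chi> d. w d)"
    unfolding matrix_vector_mul_assoc[symmetric]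
    using eq by (simp add: matrix_vector_mult_def transpose_def vec_eq_iff)
  then have "(\<chi> d. v d) = (\<chi> d. w d)" by (rule invertible_cancel[OF inv])
  then show ?thesis by (simp add: vec_eq_iff)
qed

text \<open>The transformation law $\partial_l\phi^a\,\Gamma^l_{ij} = \partial_i\partial_j\phi^a +
  \Gamma'^a_{bc}\,\partial_i\phi^b\,\partial_j\phi^c$ of the Christoffel symbols: both sides have the same
  pairing with all $\partial_m\phi$ under \<open>G'\<close>.\<close>

lemma chris2_pull:
  assumes x: "x \<in> U"
  shows "(\<Sum>l\<in>UNIV. J a l x * \<Gamma> l i j x)
     = H a i j x + (\<Sum>b\<in>UNIV. \<Sum>c\<in>UNIV. \<Gamma>' a b c (\<phi> x) * J b i x * J c j x)"
proof (rule nondegenerate_pull[OF x, where v = "\<lambda>a. \<Sum>l\<in>UNIV. J a l x * \<Gamma> l i j x"])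
  fix m
  have "(\<Sum>c\<in>UNIV. J c m x * (\<Sum>d\<in>UNIV. G' c d (\<phi> x) * (\<Sum>l\<in>UNIV. J d l x * \<Gamma> l i j x)))
      = (\<Sum>c\<in>UNIV. \<Sum>d\<in>UNIV. \<Sum>l\<in>UNIV. G' c d (\<phi> x) * J c m x * J d l x * \<Gamma> l i j x)"
    by (simp add: sum_distrib_left mult_ac)
  also have "\<dots> = (\<Sum>l\<in>UNIV. G m l x * \<Gamma> l i j x)"
    by (subst sum_rotate[symmetric]) (simp add: pullback[OF x] sum_distrib_right)
  also have "\<dots> = chris1 G m i j x" by (rule L.lower_chris2[OF x])
  also have "\<dots> = (\<Sum>c\<in>UNIV. J c m x * (\<Sum>d\<in>UNIV. G' c d (\<phi> x) * 
      (H d i j x + (\<Sum>b\<in>UNIV. \<Sum>e\<in>UNIV. \<Gamma>' d b e (\<phi> x) * J b i x * J e j x))))"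
  proof -
    have "(\<Sum>c\<in>UNIV. \<Sum>a\<in>UNIV. \<Sum>b\<in>UNIV. chris1 G' c a b (\<phi> x) * J a i x * J b j x * J c m x)
      = (\<Sum>c\<in>UNIV. J c m x * (\<Sum>a\<in>UNIV. \<Sum>b\<in>UNIV. \<Sum>d\<in>UNIV. 
          G' c d (\<phi> x) * \<Gamma>' d a b (\<phi> x) * J a i x * J b j x))"
      by (simp add: L'.lower_chris2[OF maps[OF x], symmetric] sum_distrib_left sum_distrib_right mult_ac)
    also have "\<dots> = (\<Sum>c\<in>UNIV. J c m x * (\<Sum>d\<in>UNIV. G' c d (\<phi> x) *
          (\<Sum>b\<in>UNIV. \<Sum>e\<in>UNIV. \<Gamma>' d b e (\<phi> x) * J b i x * J e j x)))"
      by (subst sum_rotate[symmetric]) (simp add: sum_distrib_left mult_ac)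
    finally have 1: "(\<Sum>c\<in>UNIV. \<Sum>a\<in>UNIV. \<Sum>b\<in>UNIV. chris1 G' c a b (\<phi> x) * J a i x * J b j x * J c m x) = \<dots>" .
    have 2: "(\<Sum>a\<in>UNIV. \<Sum>b\<in>UNIV. G' a b (\<phi> x) * H a i j x * J b m x)
      = (\<Sum>c\<in>UNIV. J c m x * (\<Sum>d\<in>UNIV. G' c d (\<phi> x) * H d i j x))"
      by (subst sum.swap) (simp add: sum_distrib_left L'.sym_G[OF maps[OF x]] mult_ac)
    show ?thesis
      unfolding chris1_pull[OF x] 1 2 by (simp add: sum.distrib distrib_left)
  qed
  finally show "(\<Sum>c\<in>UNIV. J c m x * (\<Sum>d\<in>UNIV. G' c d (\<phi> x) * (\<Sum>l\<in>UNIV. J d l x * \<Gamma> l i j x))) = \<dots>" .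
qed

text \<open>Tensoriality of the curvature. The law \<open>chris2_pull\<close> is differentiated in direction \<open>i\<close>, and the
  second derivatives of \<open>\<phi>\<close> that multiply Christoffel symbols linearly are eliminated by means of the same
  law. Antisymmetrizing in \<open>i\<close> and \<open>j\<close> removes everything but the curvature components: the third
  derivatives of \<open>\<phi>\<close> and the terms \<open>Y\<close> are symmetric, and the mixed terms \<open>X\<close> occur on both sides.\<close>

lemma curv_pull:
  assumes x: "x \<in> U"
  shows "(\<Sum>l\<in>UNIV. J a l x * curv \<Gamma> l i j k x)
    = (\<Sum>b\<in>UNIV. \<Sum>c\<in>UNIV. \<Sum>d\<in>UNIV. curv \<Gamma>' a b c d (\<phi> x) * J b i x * J c j x * J d k x)"
proof -
  define A where "A i j = (\<Sum>l\<in>UNIV. J a l x * pd i (\<Gamma> l j k) x)" for i j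
  define B where "B i j = (\<Sum>l\<in>UNIV. J a l x * (\<Sum>m\<in>UNIV. \<Gamma> l i m x * \<Gamma> m j k x))" for i j
  define A' where "A' i j = (\<Sum>b\<in>UNIV. \<Sum>c\<in>UNIV. \<Sum>d\<in>UNIV. pd b (\<Gamma>' a c d) (\<phi> x) * J b i x * J c j x * J d k x)" for i j
  define B' where "B' i j = (\<Sum>b\<in>UNIV. \<Sum>c\<in>UNIV. \<Sum>d\<in>UNIV. 
      (\<Sum>m\<in>UNIV. \<Gamma>' a b m (\<phi> x) * \<Gamma>' m c d (\<phi> x)) * J b i x * J c j x * J d k x)" for i j
  define X where "X i j = (\<Sum>b\<in>UNIV. \<Sum>c\<in>UNIV. \<Gamma>' a b c (\<phi> x) * J b i x * (\<Sum>l\<in>UNIV. J c l x * \<Gamma> l j k x))" for i j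
  define Y where "Y i j = (\<Sum>b\<in>UNIV. \<Sum>c\<in>UNIV. \<Gamma>' a b c (\<phi> x) * H b i j x * J c k x)" for i j
  have lhs: "pd i (\<lambda>x. \<Sum>l\<in>UNIV. J a l x * \<Gamma> l j k x) x = A i j + B i j - X i j" for i j
  proof -
    have "pd i (\<lambda>x. \<Sum>l\<in>UNIV. J a l x * \<Gamma> l j k x) x
        = (\<Sum>l\<in>UNIV. H a i l x * \<Gamma> l j k x) + A i j"
      by (subst pd_sum) (simp_all add: differentiable_mult diff_J L.diff_chris2 x pd_mult sum.distrib A_def)
    also have "(\<Sum>l\<in>UNIV. H a i l x * \<Gamma> l j k x)
        = (\<Sum>m\<in>UNIV. (\<Sum>l\<in>UNIV. J a l x * \<Gamma> l i m x) * \<Gamma> m j k x)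
        - (\<Sum>l\<in>UNIV. (\<Sum>b\<in>UNIV. \<Sum>c\<in>UNIV. \<Gamma>' a b c (\<phi> x) * J b i x * J c l x) * \<Gamma> l j k x)"
      by (simp add: chris2_pull[OF x] sum_subtractf[symmetric] left_diff_distrib[symmetric])
    also have "(\<Sum>m\<in>UNIV. (\<Sum>l\<in>UNIV. J a l x * \<Gamma> l i m x) * \<Gamma> m j k x) = B i j"
      unfolding B_def sum_distrib_left sum_distrib_right by (subst sum.swap) (simp add: mult_ac)
    also have "(\<Sum>l\<in>UNIV. (\<Sum>b\<in>UNIV. \<Sum>c\<in>UNIV. \<Gamma>' a b c (\<phi> x) * J b i x * J c l x) * \<Gamma> l j k x) = X i j"
      unfolding X_def sum_distrib_left sum_distrib_right by (subst sum_rotate) (simp add: mult_ac)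
    finally show ?thesis by simp
  qed
  have rhs: "pd i (\<lambda>x. \<Sum>l\<in>UNIV. J a l x * \<Gamma> l j k x) x
      = pd i (H a j k) x + A' i j + Y i j + X j i - B' j i" for i j
  proof -
    have dG: "(\<lambda>x. \<Gamma>' a b c (\<phi> x)) differentiable (at x)" for b c
      by (rule diff_pull[OF x L'.smooth_chris2])
    have "pd i (\<lambda>x. \<Sum>l\<in>UNIV. J a l x * \<Gamma> l j k x) x
        = pd i (\<lambda>x. H a j k x + (\<Sum>b\<in>UNIV. \<Sum>c\<in>UNIV. \<Gamma>' a b c (\<phi> x) * J b j x * J c k x)) x"
      by (rule pd_cong[OF L.open_U x chris2_pull])
    also have "\<dots> = pd i (H a j k) x 
        + pd i (\<lambda>x. \<Sum>b\<in>UNIV. \<Sum>c\<in>UNIV. \<Gamma>' a b c (\<phi> x) * J b j x * J c k x) x"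
      by (intro pd_add diff_H x differentiable_sum ballI differentiable_mult dG diff_J finite)
    also have "pd i (\<lambda>x. \<Sum>b\<in>UNIV. \<Sum>c\<in>UNIV. \<Gamma>' a b c (\<phi> x) * J b j x * J c k x) x
        = (\<Sum>b\<in>UNIV. \<Sum>c\<in>UNIV. pd i (\<lambda>x. \<Gamma>' a b c (\<phi> x) * J b j x * J c k x) x)"
      by (intro pd_sum_sum differentiable_mult dG diff_J x)
    also have "\<dots> = (\<Sum>b\<in>UNIV. \<Sum>c\<in>UNIV. (\<Sum>d\<in>UNIV. pd d (\<Gamma>' a b c) (\<phi> x) * J d i x) * J b j x * J c k x
        + \<Gamma>' a b c (\<phi> x) * H b i j x * J c k x + \<Gamma>' a b c (\<phi> x) * J b j x * H c i k x)"
      by (intro sum.cong refl)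
        (simp add: pd_mult differentiable_mult dG diff_J x pd_pull[OF x L'.smooth_chris2] algebra_simps)
    also have "\<dots> = (\<Sum>b\<in>UNIV. \<Sum>c\<in>UNIV. (\<Sum>d\<in>UNIV. pd d (\<Gamma>' a b c) (\<phi> x) * J d i x) * J b j x * J c k x)
        + Y i j + (\<Sum>b\<in>UNIV. \<Sum>c\<in>UNIV. \<Gamma>' a b c (\<phi> x) * J b j x * H c i k x)"
      by (simp add: sum.distrib Y_def)
    also have "(\<Sum>b\<in>UNIV. \<Sum>c\<in>UNIV. (\<Sum>d\<in>UNIV. pd d (\<Gamma>' a b c) (\<phi> x) * J d i x) * J b j x * J c k x) = A' i j"
      unfolding A'_def sum_distrib_left sum_distrib_right by (subst sum_rotate[symmetric]) (simp add: mult_ac)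
    also have "(\<Sum>b\<in>UNIV. \<Sum>c\<in>UNIV. \<Gamma>' a b c (\<phi> x) * J b j x * H c i k x) = X j i - B' j i"
    proof -
      have "(\<Sum>b\<in>UNIV. \<Sum>c\<in>UNIV. \<Gamma>' a b c (\<phi> x) * J b j x * H c i k x)
        = X j i - (\<Sum>b\<in>UNIV. \<Sum>m\<in>UNIV. \<Gamma>' a b m (\<phi> x) * J b j x *
            (\<Sum>c\<in>UNIV. \<Sum>d\<in>UNIV. \<Gamma>' m c d (\<phi> x) * J c i x * J d k x))"
        by (simp add: X_def chris2_pull[OF x] distrib_left sum.distrib)
      also have "(\<Sum>b\<in>UNIV. \<Sum>m\<in>UNIV. \<Gamma>' a b m (\<phi> x) * J b j x *
            (\<Sum>c\<in>UNIV. \<Sum>d\<in>UNIV. \<Gamma>' m c d (\<phi> x) * J c i x * J d k x)) = B' j i"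
        unfolding B'_def sum_distrib_left sum_distrib_right
        by (rule sum.cong[OF refl], subst sum_rotate) (simp add: mult_ac)
      finally show ?thesis .
    qed
    finally show ?thesis by simp
  qed
  have Hs: "pd i (H a j k) x = pd j (H a i k) x"
    by (rule pd_commute[OF L.open_U smooth_on_pd[OF smooth_\<phi>] x])
  have Ys: "Y i j = Y j i" unfolding Y_def by (simp add: H_sym[OF x])
  have "(\<Sum>l\<in>UNIV. J a l x * curv \<Gamma> l i j k x) = (A i j + B i j) - (A j i + B j i)"
    unfolding A_def B_def curv_def by (simp add: sum_subtractf sum.distrib algebra_simps)
  also have "\<dots> = (A' i j + B' i j) - (A' j i + B' j i)"
    using lhs[of i j] lhs[of j i] rhs[of i j] rhs[of j i] Hs Ys by linarith
  also have "\<dots> = (\<Sum>b\<in>UNIV. \<Sum>c\<in>UNIV. \<Sum>d\<in>UNIV. curv \<Gamma>' a b c d (\<phi> x) * J b i x * J c j x * J d k x)"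
  proof -
    have sA: "A' j i = (\<Sum>b\<in>UNIV. \<Sum>c\<in>UNIV. \<Sum>d\<in>UNIV. pd c (\<Gamma>' a b d) (\<phi> x) * J b i x * J c j x * J d k x)"
      unfolding A'_def by (subst sum.swap) (simp add: mult_ac)
    have sB: "B' j i = (\<Sum>b\<in>UNIV. \<Sum>c\<in>UNIV. \<Sum>d\<in>UNIV. 
      (\<Sum>m\<in>UNIV. \<Gamma>' a c m (\<phi> x) * \<Gamma>' m b d (\<phi> x)) * J b i x * J c j x * J d k x)"
      unfolding B'_def by (subst sum.swap) (simp add: mult_ac)
    show ?thesis
      unfolding sA sB unfolding A'_def B'_def curv_def sum.distrib[symmetric] sum_subtractf[symmetric]
      by (intro sum.cong refl) (simp add: sum_subtractf algebra_simps)
  qed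
  finally show ?thesis .
qed

end

text \<open>The matrix of components of the Ricci tensor, $S(\partial_j,\partial_k) = R^l{}_{ljk}$ in the index
  order of \<open>curv\<close>.\<close>

definition ricci :: "('n \<Rightarrow> 'n \<Rightarrow> real^'n::finite \<Rightarrow> real) \<Rightarrow> real^'n \<Rightarrow> real^'n^'n" where
  "ricci G x = (\<chi> j k. \<Sum>l\<in>UNIV. curv (chris2 G) l l j k x)"

text \<open>The scalar curvature $G^{jk}S_{jk}$ in coordinates, as the trace of a matrix product.\<close>

definition scalar :: "('n \<Rightarrow> 'n \<Rightarrow> real^'n::finite \<Rightarrow> real) \<Rightarrow> real^'n \<Rightarrow> real" where
  "scalar G x = trace (matrix_inv (\<chi> i j. G i j x) ** ricci G x)"

lemma (in local_metric) smooth_scalar: "smooth_on U (scalar G)"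
  unfolding scalar_def[abs_def] trace_def matrix_matrix_mult_def ricci_def
  by (simp, intro smooth_on_sum smooth_on_mult smooth_on_matrix_inv smooth_curv smooth_G open_U inv_G)

context metric_change
begin

lemma ricci_pull:
  assumes x: "x \<in> U"
  shows "ricci G x = transpose (\<chi> a i. J a i x) ** ricci G' (\<phi> x) ** (\<chi> a i. J a i x)"
proof -
  define K where "K = matrix_inv (\<chi> a i. J a i x)"
  have KJ: "(\<Sum>a\<in>UNIV. K $ i $ a * J a l x) = (if i = l then 1 else 0)" for i l
    using matrix_inv_left[OF inv_J[OF x]]
    by (simp add: K_def[symmetric] matrix_matrix_mult_def mat_def vec_eq_iff)
  have JK: "(\<Sum>i\<in>UNIV. J b i x * K $ i $ a) = (if b = a then 1 else 0)" for a b
    using matrix_inv_right[OF inv_J[OF x]]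
    by (simp add: K_def[symmetric] matrix_matrix_mult_def mat_def vec_eq_iff)
  have "ricci G x $ j $ k = (\<Sum>c\<in>UNIV. \<Sum>d\<in>UNIV. ricci G' (\<phi> x) $ c $ d * J c j x * J d k x)" for j k
  proof -
    have "ricci G x $ j $ k = (\<Sum>i\<in>UNIV. \<Sum>l\<in>UNIV. (if i = l then 1 else 0) * curv \<Gamma> l i j k x)"
      by (simp add: ricci_def if_distrib[of "\<lambda>u. u * _"] cong: if_cong)
    also have "\<dots> = (\<Sum>i\<in>UNIV. \<Sum>a\<in>UNIV. K $ i $ a * (\<Sum>l\<in>UNIV. J a l x * curv \<Gamma> l i j k x))"
      unfolding KJ[symmetric] sum_distrib_left sum_distrib_right
      by (rule sum.cong[OF refl], subst sum.swap) (simp add: mult_ac)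
    also have "\<dots> = (\<Sum>i\<in>UNIV. \<Sum>a\<in>UNIV. \<Sum>b\<in>UNIV. (J b i x * K $ i $ a) *
        (\<Sum>c\<in>UNIV. \<Sum>d\<in>UNIV. curv \<Gamma>' a b c d (\<phi> x) * J c j x * J d k x))"
      unfolding curv_pull[OF x] sum_distrib_left by (simp add: mult_ac)
    also have "\<dots> = (\<Sum>a\<in>UNIV. \<Sum>b\<in>UNIV. (if b = a then 1 else 0) *
        (\<Sum>c\<in>UNIV. \<Sum>d\<in>UNIV. curv \<Gamma>' a b c d (\<phi> x) * J c j x * J d k x))"
      by (subst sum_rotate) (simp only: sum_distrib_right[symmetric] JK)
    also have "\<dots> = (\<Sum>a\<in>UNIV. \<Sum>c\<in>UNIV. \<Sum>d\<in>UNIV. curv \<Gamma>' a a c d (\<phi> x) * J c j x * J d k x)"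
      by (simp add: if_distrib[of "\<lambda>u. u * _"] cong: if_cong)
    also have "\<dots> = (\<Sum>c\<in>UNIV. \<Sum>d\<in>UNIV. ricci G' (\<phi> x) $ c $ d * J c j x * J d k x)"
      by (subst sum_rotate) (simp add: ricci_def sum_distrib_right)
    finally show ?thesis .
  qed
  then show ?thesis
    by (simp add: vec_eq_iff matrix_matrix_mult_def transpose_def sum_distrib_right sum_distrib_left)
       (subst sum.swap, simp add: mult_ac)
qed

lemma scalar_pull:
  assumes x: "x \<in> U"
  shows "scalar G x = scalar G' (\<phi> x)"
proof -
  let ?J = "\<chi> a i. J a i x" and ?G = "\<chi> i j. G i j x" and ?G' = "\<chi> i j. G' i j (\<phi> x)"
  let ?K = "matrix_inv ?J"
  let ?P = "matrix_inv ?G ** ricci G x" and ?P' = "matrix_inv ?G' ** ricci G' (\<phi> x)"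
  note KJ = matrix_inv_left[OF inv_J[OF x]] and JK = matrix_inv_right[OF inv_J[OF x]]
  have G: "?G = transpose ?J ** ?G' ** ?J"
    by (simp add: vec_eq_iff matrix_matrix_mult_def transpose_def sum_distrib_right sum_distrib_left pullback[OF x])
       (subst sum.swap, simp add: mult_ac)
  have "?G ** (?K ** ?P' ** ?J) = transpose ?J ** (?G' ** ((?J ** ?K) ** (?P' ** ?J)))"
    unfolding G by (simp only: matrix_mul_assoc)
  also have "\<dots> = transpose ?J ** ((?G' ** matrix_inv ?G') ** (ricci G' (\<phi> x) ** ?J))"
    unfolding JK by (simp only: matrix_mul_assoc matrix_mul_lid)
  also have "\<dots> = ricci G x"
    unfolding matrix_inv_right[OF L'.inv_G[OF maps[OF x]]] ricci_pull[OF x]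
    by (simp only: matrix_mul_assoc matrix_mul_lid)
  \<comment> \<open>The Ricci operators in the two coordinate systems are conjugate by the Jacobian.\<close>
  finally have "?P = matrix_inv ?G ** (?G ** (?K ** ?P' ** ?J))" by simp
  also have "\<dots> = ?K ** ?P' ** ?J"
    unfolding matrix_mul_assoc matrix_inv_left[OF L.inv_G[OF x]] by simp
  finally have "trace ?P = trace (?J ** (?K ** ?P'))" by (simp add: trace_mul_sym[of ?J])
  also have "\<dots> = trace ?P'" unfolding matrix_mul_assoc JK by simp
  finally show ?thesis unfolding scalar_def .
qed

end

section \<open>Charts, Jacobians and the components of the metric\<close>

lemma cinv_snd: "is_chart c \<Longrightarrow> q \<in> fst c \<Longrightarrow> cinv c (snd c q) = q"
  unfolding is_chart_def homeomorphism_def by blast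

lemma snd_cinv: "is_chart c \<Longrightarrow> x \<in> cimage c \<Longrightarrow> snd c (cinv c x) = x"
  unfolding is_chart_def homeomorphism_def by blast

lemma cinv_in: "is_chart c \<Longrightarrow> x \<in> cimage c \<Longrightarrow> cinv c x \<in> fst c"
  unfolding is_chart_def homeomorphism_def by blast

lemma snd_in_cimage: "q \<in> fst c \<Longrightarrow> snd c q \<in> cimage c"
  unfolding cimage_def by blast

lemma transition_snd: "is_chart c \<Longrightarrow> q \<in> fst c \<Longrightarrow> transition c c' (snd c q) = snd c' q"
  by (simp add: transition_def cinv_snd)

text \<open>The common domain of two charts, in the coordinates of the first one; it is the natural domain
  of the transition map.\<close>

definition overlap :: "('p, 'n::finite) chart \<Rightarrow> ('p, 'n) chart \<Rightarrow> (real^'n) set" where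
  "overlap c c' = snd c ` (fst c \<inter> fst c')"

lemma overlap_subset: "overlap c c' \<subseteq> cimage c"
  unfolding overlap_def cimage_def by blast

lemma open_overlap:
  assumes "is_chart c" "is_chart c'"
  shows "open (overlap c c')"
proof -
  have "overlap c c' = cimage c \<inter> cinv c -` fst c'"
    unfolding overlap_def cimage_def
    using cinv_snd[OF assms(1)] by auto
  moreover have "open (cimage c)" "continuous_on (cimage c) (cinv c)" "open (fst c')"
    using assms unfolding is_chart_def homeomorphism_def by blast+
  ultimately show ?thesis using continuous_open_preimage by metis
qed

context
  fixes M :: "('p::{t2_space, second_countable_topology}, 'n::finite) mfd"
  assumes M: "smooth_manifold M"
begin

lemma is_chart_atlas: "c \<in> atlas M \<Longrightarrow> is_chart c"
  using M unfolding smooth_manifold_def by blast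

lemma fst_carrier: "c \<in> atlas M \<Longrightarrow> q \<in> fst c \<Longrightarrow> q \<in> carrier M"
  unfolding carrier_def by blast

lemma pchart_atlas: "q \<in> carrier M \<Longrightarrow> pchart M q \<in> atlas M"
  using M unfolding smooth_manifold_def by blast

lemma pchart_fst: "q \<in> carrier M \<Longrightarrow> q \<in> fst (pchart M q)"
  using M unfolding smooth_manifold_def by blast

lemma smooth_transition:
  "c \<in> atlas M \<Longrightarrow> c' \<in> atlas M \<Longrightarrow> smooth_on (overlap c c') (\<lambda>x. transition c c' x $ i)"
  using M unfolding smooth_manifold_def overlap_def by blast

lemma diff_transition:
  assumes "c \<in> atlas M" "c' \<in> atlas M" "x \<in> overlap c c'"
  shows "transition c c' differentiable (at x)"
  using smooth_on_differentiable[OF smooth_transition[OF assms(1,2)] assms(3)]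
  by (auto simp: differentiable_componentwise_within[of "transition c c'"] Basis_vec_def inner_axis)

lemma jac_component:
  assumes "c \<in> atlas M" "c' \<in> atlas M" "q \<in> fst c" "q \<in> fst c'"
  shows "jac c c' q $ a $ i = pd i (\<lambda>x. transition c c' x $ a) (snd c q)"
  unfolding jac_def matrix_def
  using pd_component[OF diff_transition[OF assms(1,2), of "snd c q"]] assms
  by (simp add: overlap_def)

lemma jac_self:
  assumes "c \<in> atlas M" "q \<in> fst c"
  shows "jac c c q = mat 1"
proof -
  have "((\<lambda>x. x) has_derivative (\<lambda>x. x)) (at (snd c q))" by simp
  then have "(transition c c has_derivative (\<lambda>x. x)) (at (snd c q))"
  proof (rule has_derivative_transform_within_open)
    show "open (cimage c)" using is_chart_atlas[OF assms(1)] unfolding is_chart_def by blast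
    show "snd c q \<in> cimage c" using assms(2) by (rule snd_in_cimage)
  qed (simp add: transition_def snd_cinv is_chart_atlas assms(1))
  then show ?thesis
    unfolding jac_def by (simp add: frechet_derivative_at[symmetric] matrix_id_mat_1[unfolded id_def])
qed

lemma jac_chain:
  assumes "c \<in> atlas M" "c' \<in> atlas M" "c'' \<in> atlas M" "q \<in> fst c" "q \<in> fst c'" "q \<in> fst c''"
  shows "jac c c'' q = jac c' c'' q ** jac c c' q"
proof -
  let ?x = "snd c q"
  have T: "transition c c' ?x = snd c' q" using transition_snd is_chart_atlas assms by blast
  have d: "transition c c' differentiable (at ?x)" "transition c c'' differentiable (at ?x)"
    "transition c' c'' differentiable (at (snd c' q))"
    by (rule diff_transition; use assms in \<open>simp add: overlap_def\<close>)+
  have 1: "frechet_derivative (transition c c'') (at ?x)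
      = frechet_derivative (transition c' c'' \<circ> transition c c') (at ?x)"
  proof (rule frechet_derivative_transform_within_open[OF d(2) open_overlap])
    show "is_chart c" "is_chart c'" using is_chart_atlas assms by blast+
    show "?x \<in> overlap c c'" using assms by (simp add: overlap_def)
    show "transition c c'' x = (transition c' c'' \<circ> transition c c') x" if "x \<in> overlap c c'" for x
      using that unfolding overlap_def
      by (auto simp: transition_snd is_chart_atlas assms)
  qed
  have 2: "\<dots> = frechet_derivative (transition c' c'') (at (snd c' q))
      \<circ> frechet_derivative (transition c c') (at ?x)"
    using frechet_derivative_compose[of "transition c c'" ?x "transition c' c''"] d T by simp
  show ?thesis
    unfolding jac_def 1 2
    by (rule matrix_compose) (use d frechet_derivative_works has_derivative_linear in blast)+
qed

lemma invertible_jac: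
  assumes "c \<in> atlas M" "c' \<in> atlas M" "q \<in> fst c" "q \<in> fst c'"
  shows "invertible (jac c c' q)"
  unfolding invertible_def
  using jac_chain[of c c' c q] jac_chain[of c' c c' q] jac_self[of c q] jac_self[of c' q] assms by metis

end

lemma bilinear_expand:
  fixes B :: "real^'n::finite \<Rightarrow> real^'n \<Rightarrow> real"
  assumes "bilinear B"
  shows "B (\<Sum>a\<in>UNIV. u a *\<^sub>R v a) (\<Sum>b\<in>UNIV. w b *\<^sub>R z b)
    = (\<Sum>a\<in>UNIV. \<Sum>b\<in>UNIV. B (v a) (z b) * u a * w b)"
proof -
  have 1: "linear (\<lambda>x. B x y)" and 2: "linear (B y)" for y
    using assms unfolding bilinear_def by auto
  show ?thesis
    by (simp add: linear_sum[OF 1] linear_sum[OF 2] linear_cmul[OF 1] linear_cmul[OF 2] sum_distrib_left)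
       (subst sum.swap, simp add: mult_ac)
qed

lemma matrix_vector_mult_axis_sum:
  fixes A :: "real^'n::finite^'m::finite"
  shows "A *v (\<Sum>a\<in>UNIV. u a *\<^sub>R axis a 1) = (\<Sum>a\<in>UNIV. u a *\<^sub>R (A *v axis a 1))"
  by (simp add: linear_sum[OF matrix_vector_mul_linear] linear_cmul[OF matrix_vector_mul_linear])

lemma axis_expand: "(v :: real^'n::finite) = (\<Sum>a\<in>UNIV. v $ a *\<^sub>R axis a 1)"
  using basis_expansion[of v] by (simp add: scalar_mult_eq_scaleR)

context
  fixes M :: "('p::{t2_space, second_countable_topology}, 'n::finite) mfd"
    and g :: "('p, 'n) metric"
  assumes sr: "semi_riemannian M g"
begin

lemma sr_manifold: "smooth_manifold M"
  using sr unfolding semi_riemannian_def by blast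

lemma sr_bilinear: "p \<in> carrier M \<Longrightarrow> bilinear (g p)"
  using sr unfolding semi_riemannian_def by blast

lemma sr_sym: "p \<in> carrier M \<Longrightarrow> g p x y = g p y x"
  using sr unfolding semi_riemannian_def by blast

lemma sr_nondegenerate: "p \<in> carrier M \<Longrightarrow> (\<And>y. g p x y = 0) \<Longrightarrow> x = 0"
  using sr unfolding semi_riemannian_def by blast

lemma gcomp_snd:
  assumes "c \<in> atlas M" "q \<in> fst c"
  shows "gcomp M g c i j (snd c q)
    = g q (jac c (pchart M q) q *v axis i 1) (jac c (pchart M q) q *v axis j 1)"
  by (simp add: gcomp_def Let_def cinv_snd is_chart_atlas[OF sr_manifold] assms)

text \<open>The components of the metric at \<open>q\<close> in the chart \<open>c\<close>, as a bilinear form.\<close>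

lemma gcomp_bilinear:
  assumes "c \<in> atlas M" "q \<in> fst c"
  shows "g q (jac c (pchart M q) q *v u) (jac c (pchart M q) q *v w)
    = (\<Sum>i\<in>UNIV. \<Sum>j\<in>UNIV. gcomp M g c i j (snd c q) * u $ i * w $ j)"
proof -
  have q: "q \<in> carrier M" using fst_carrier[OF sr_manifold] assms by blast
  show ?thesis
    by (subst axis_expand[of u], subst axis_expand[of w])
       (simp only: matrix_vector_mult_axis_sum bilinear_expand[OF sr_bilinear[OF q]] gcomp_snd[OF assms])
qed

text \<open>The components in two charts are related by the Jacobian, by the chain rule through the
  preferred chart.\<close>

lemma gcomp_change:
  assumes "c \<in> atlas M" "c' \<in> atlas M" "q \<in> fst c" "q \<in> fst c'"
  shows "gcomp M g c i j (snd c q)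
    = (\<Sum>a\<in>UNIV. \<Sum>b\<in>UNIV. gcomp M g c' a b (snd c' q) * jac c c' q $ a $ i * jac c c' q $ b $ j)"
proof -
  let ?P = "pchart M q"
  have q: "q \<in> carrier M" using fst_carrier[OF sr_manifold] assms by blast
  have J: "jac c ?P q *v v = jac c' ?P q *v (jac c c' q *v v)" for v
    using jac_chain[OF sr_manifold assms(1,2) pchart_atlas[OF sr_manifold q] assms(3,4) pchart_fst[OF sr_manifold q]]
    by (simp add: matrix_vector_mul_assoc)
  have "(jac c c' q *v axis i 1) $ a = jac c c' q $ a $ i" for a i
    by (simp add: matrix_vector_mul_component inner_axis)
  then show ?thesis
    unfolding gcomp_snd[OF assms(1,3)] J gcomp_bilinear[OF assms(2,4)] by simp
qed

lemma invertible_gcomp: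
  assumes "c \<in> atlas M" "q \<in> fst c"
  shows "invertible (\<chi> i j. gcomp M g c i j (snd c q))"
proof -
  let ?A = "\<chi> i j. gcomp M g c i j (snd c q)" and ?J = "jac c (pchart M q) q"
  have q: "q \<in> carrier M" using fst_carrier[OF sr_manifold] assms by blast
  have invJ: "invertible ?J"
    by (rule invertible_jac[OF sr_manifold]) (use assms pchart_atlas[OF sr_manifold q] pchart_fst[OF sr_manifold q] in auto)
  have "v = 0" if "?A *v v = 0" for v
  proof -
    have "g q (?J *v v) y = 0" for y
    proof -
      obtain w where w: "y = ?J *v w"
        using matrix_inv_right[OF invJ] by (metis matrix_vector_mul_assoc matrix_vector_mul_lid)
      have "g q (?J *v v) y = g q (?J *v w) (?J *v v)" unfolding w by (rule sr_sym[OF q])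
      also have "\<dots> = (\<Sum>i\<in>UNIV. w $ i * (?A *v v) $ i)"
        unfolding gcomp_bilinear[OF assms]
        by (simp add: matrix_vector_mult_def sum_distrib_left mult_ac)
      finally show ?thesis using that by simp
    qed
    then have "?J *v v = ?J *v 0" using sr_nondegenerate[OF q] by simp
    then show ?thesis by (rule invertible_cancel[OF invJ])
  qed
  then have "\<exists>B. B ** ?A = mat 1" using matrix_left_invertible_ker[of ?A] by blast
  then show ?thesis by (simp add: invertible_left_inverse)
qed

lemma local_metric_gcomp:
  assumes "c \<in> atlas M" "open U" "U \<subseteq> cimage c"
  shows "local_metric U (gcomp M g c)"
proof
  show "open U" by fact
  show "smooth_on U (gcomp M g c i j)" for i j
    using sr assms smooth_on_subset unfolding semi_riemannian_def by blast
  fix x assume "x \<in> U"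
  then obtain q where q: "q \<in> fst c" "x = snd c q" using assms(3) unfolding cimage_def by blast
  show "gcomp M g c i j x = gcomp M g c j i x" for i j
    unfolding q(2) gcomp_snd[OF assms(1) q(1)]
    by (rule sr_sym) (use fst_carrier[OF sr_manifold] assms q in blast)
  show "invertible (\<chi> i j. gcomp M g c i j x)"
    unfolding q(2) by (rule invertible_gcomp[OF assms(1) q(1)])
qed

lemma metric_change_transition:
  assumes c: "c \<in> atlas M" and c': "c' \<in> atlas M"
  shows "metric_change (overlap c c') (gcomp M g c) (cimage c') (gcomp M g c') (transition c c')"
proof -
  note ch = is_chart_atlas[OF sr_manifold c] is_chart_atlas[OF sr_manifold c']
  interpret L: local_metric "overlap c c'" "gcomp M g c"
    by (rule local_metric_gcomp[OF c open_overlap[OF ch] overlap_subset])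
  interpret L': local_metric "cimage c'" "gcomp M g c'"
    by (rule local_metric_gcomp[OF c']) (use ch(2) in \<open>auto simp: is_chart_def\<close>)
  show ?thesis
  proof
    show "smooth_on (overlap c c') (\<lambda>x. transition c c' x $ a)" for a
      by (rule smooth_transition[OF sr_manifold c c'])
    fix x assume "x \<in> overlap c c'"
    then obtain q where q: "q \<in> fst c" "q \<in> fst c'" and x: "x = snd c q" unfolding overlap_def by blast
    note T = transition_snd[OF ch(1) q(1), of c']
    note Jc = jac_component[OF sr_manifold c c' q, symmetric]
    show "transition c c' x \<in> cimage c'" unfolding x T by (rule snd_in_cimage[OF q(2)])
    show "invertible (\<chi> a i. pd i (\<lambda>x. transition c c' x $ a) x)"
      unfolding x Jc using invertible_jac[OF sr_manifold c c' q] by simp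
    show "gcomp M g c i j x = (\<Sum>a\<in>UNIV. \<Sum>b\<in>UNIV. gcomp M g c' a b (transition c c' x)
        * pd i (\<lambda>x. transition c c' x $ a) x * pd j (\<lambda>x. transition c c' x $ b) x)" for i j
      unfolding x Jc T by (rule gcomp_change[OF c c' q])
  qed
qed

end

section \<open>Curvature at a point and smoothness of the scalar curvature\<close>

text \<open>The metric components in the preferred chart at \<open>p\<close>, and the coordinates of \<open>p\<close>.\<close>

abbreviation pmetric :: "('p, 'n::finite) mfd \<Rightarrow> ('p, 'n) metric \<Rightarrow> 'p \<Rightarrow> 'n \<Rightarrow> 'n \<Rightarrow> real^'n \<Rightarrow> real" where
  "pmetric M g p \<equiv> gcomp M g (pchart M p)"

abbreviation pcoord :: "('p, 'n::finite) mfd \<Rightarrow> 'p \<Rightarrow> real^'n" where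
  "pcoord M p \<equiv> snd (pchart M p) p"

lemma christoffel_eq: "christoffel M g c = chris2 (gcomp M g c)"
  by (intro ext) (simp add: christoffel_def chris2_def chris1_def sum_distrib_left)

lemma riem_comp_eq: "riem_comp M g c = curv (chris2 (gcomp M g c))"
  by (intro ext) (simp add: riem_comp_def curv_def christoffel_eq)

lemma trace_matrix: "trace (matrix f) = (\<Sum>l\<in>UNIV. f (axis l 1) $ l)"
  by (simp add: trace_def matrix_def)

lemma sum_swap_pairs:
  "(\<Sum>a\<in>A. \<Sum>b\<in>B. \<Sum>c\<in>C. \<Sum>d\<in>D. f a b c d) = (\<Sum>c\<in>C. \<Sum>d\<in>D. \<Sum>a\<in>A. \<Sum>b\<in>B. f a b c d)"
proof -
  have "(\<Sum>a\<in>A. \<Sum>b\<in>B. \<Sum>c\<in>C. \<Sum>d\<in>D. f a b c d) = (\<Sum>a\<in>A. \<Sum>c\<in>C. \<Sum>d\<in>D. \<Sum>b\<in>B. f a b c d)"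
    by (intro sum.cong refl sum_rotate)
  also have "\<dots> = (\<Sum>c\<in>C. \<Sum>d\<in>D. \<Sum>a\<in>A. \<Sum>b\<in>B. f a b c d)" by (rule sum_rotate)
  finally show ?thesis .
qed

lemma (in local_metric) matrix_inv_sym:
  assumes "x \<in> U"
  shows "matrix_inv (\<chi> a b. G a b x) $ l $ m = matrix_inv (\<chi> a b. G a b x) $ m $ l"
proof -
  let ?A = "\<chi> a b. G a b x"
  have "transpose ?A = ?A" using sym_G[OF assms] by (simp add: transpose_def vec_eq_iff)
  then have L: "transpose (matrix_inv ?A) ** ?A = mat 1"
    using arg_cong[OF matrix_inv_right[OF inv_G[OF assms]], of transpose]
    by (simp add: matrix_transpose_mul)
  have "transpose (matrix_inv ?A) = transpose (matrix_inv ?A) ** (?A ** matrix_inv ?A)"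
    by (simp add: matrix_inv_right[OF inv_G[OF assms]])
  also have "\<dots> = matrix_inv ?A" unfolding matrix_mul_assoc L by simp
  finally have "transpose (matrix_inv ?A) = matrix_inv ?A" .
  then have "transpose (matrix_inv ?A) $ l $ m = matrix_inv ?A $ l $ m" by simp
  then show ?thesis by (simp add: transpose_def)
qed

text \<open>Pair symmetry and antisymmetry in the first pair give $R_{ljkm} = R_{mkjl}$; contraction with the
  symmetric inverse metric yields the symmetry of the Ricci tensor.\<close>

lemma (in local_metric) ricci_sym:
  assumes x: "x \<in> U"
  shows "ricci G x $ j $ k = ricci G x $ k $ j"
proof -
  let ?A = "\<chi> a b. G a b x"
  define K where "K m i j k = (\<Sum>l\<in>UNIV. G m l x * curv \<Gamma> l i j k x)" for m i j k
  have pair: "K m i j k = K j k m i" for m i j k unfolding K_def by (rule curv_pair_sym[OF x])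
  have anti: "K m i j k = - K m j i k" for m i j k
    unfolding K_def curv_antisym[of \<Gamma> _ i j k x] by (simp add: sum_negf)
  have raise: "curv \<Gamma> l i j k x = (\<Sum>m\<in>UNIV. matrix_inv ?A $ l $ m * K m i j k)" for l i j k
  proof -
    let ?v = "\<chi> l. curv \<Gamma> l i j k x"
    have "?A *v ?v = (\<chi> m. K m i j k)" by (simp add: matrix_vector_mult_def K_def vec_eq_iff)
    then have "matrix_inv ?A *v (\<chi> m. K m i j k) = matrix_inv ?A *v (?A *v ?v)" by simp
    also have "\<dots> = ?v" by (simp add: matrix_vector_mul_assoc matrix_inv_left[OF inv_G[OF x]])
    finally have "(matrix_inv ?A *v (\<chi> m. K m i j k)) $ l = ?v $ l" by simp
    then show ?thesis by (simp add: matrix_vector_mult_def)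
  qed
  have ric: "ricci G x $ j $ k = (\<Sum>l\<in>UNIV. \<Sum>m\<in>UNIV. matrix_inv ?A $ l $ m * K m l j k)" for j k
    by (simp add: ricci_def raise)
  have "K m l j k = K l m k j" for m l
    using pair[of m l j k] anti[of j k m l] pair[of j m k l] anti[of k l j m] pair[of k j l m] by simp
  then have "ricci G x $ j $ k = (\<Sum>l\<in>UNIV. \<Sum>m\<in>UNIV. matrix_inv ?A $ m $ l * K l m k j)"
    unfolding ric by (simp add: matrix_inv_sym[OF x])
  also have "\<dots> = ricci G x $ k $ j" unfolding ric by (rule sum.swap)
  finally show ?thesis .
qed

context
  fixes M :: "('p::{t2_space, second_countable_topology}, 'n::finite) mfd"
    and g :: "('p, 'n) metric"
  assumes sr: "semi_riemannian M g"
begin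

context
  fixes p assumes p: "p \<in> carrier M"
begin

lemma local_metric_pchart: "local_metric (cimage (pchart M p)) (pmetric M g p)"
  using local_metric_gcomp[OF sr pchart_atlas[OF sr_manifold[OF sr] p], of "cimage (pchart M p)"]
    is_chart_atlas[OF sr_manifold[OF sr] pchart_atlas[OF sr_manifold[OF sr] p]]
  by (simp add: is_chart_def)

lemma x0_in: "pcoord M p \<in> cimage (pchart M p)"
  by (rule snd_in_cimage[OF pchart_fst[OF sr_manifold[OF sr] p]])

lemma g_expand: "g p u w = (\<Sum>i\<in>UNIV. \<Sum>j\<in>UNIV. pmetric M g p i j (pcoord M p) * u $ i * w $ j)"
  using gcomp_bilinear[OF sr pchart_atlas[OF sr_manifold[OF sr] p] pchart_fst[OF sr_manifold[OF sr] p], of u w]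
    jac_self[OF sr_manifold[OF sr] pchart_atlas[OF sr_manifold[OF sr] p] pchart_fst[OF sr_manifold[OF sr] p]]
  by simp

lemma Riem_component: "Riem M g p X Y Z $ l
    = (\<Sum>i\<in>UNIV. \<Sum>j\<in>UNIV. \<Sum>k\<in>UNIV. curv (chris2 (pmetric M g p)) l i j k (pcoord M p) * X $ i * Y $ j * Z $ k)"
  by (simp add: Riem_def Let_def riem_comp_eq)

lemma g_Riem: "g p W (Riem M g p X Y Z) = (\<Sum>m\<in>UNIV. \<Sum>i\<in>UNIV. \<Sum>j\<in>UNIV. \<Sum>k\<in>UNIV.
    (\<Sum>l\<in>UNIV. pmetric M g p m l (pcoord M p) * curv (chris2 (pmetric M g p)) l i j k (pcoord M p)) * W $ m * X $ i * Y $ j * Z $ k)"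
proof -
  have "g p W (Riem M g p X Y Z) = (\<Sum>m\<in>UNIV. \<Sum>l\<in>UNIV. \<Sum>i\<in>UNIV. \<Sum>j\<in>UNIV. \<Sum>k\<in>UNIV.
    pmetric M g p m l (pcoord M p) * curv (chris2 (pmetric M g p)) l i j k (pcoord M p) * W $ m * X $ i * Y $ j * Z $ k)"
    unfolding g_expand Riem_component by (simp add: sum_distrib_left mult_ac)
  also have "\<dots> = (\<Sum>m\<in>UNIV. \<Sum>i\<in>UNIV. \<Sum>j\<in>UNIV. \<Sum>l\<in>UNIV. \<Sum>k\<in>UNIV.
    pmetric M g p m l (pcoord M p) * curv (chris2 (pmetric M g p)) l i j k (pcoord M p) * W $ m * X $ i * Y $ j * Z $ k)"
    by (intro sum.cong[OF refl] sum_rotate)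
  also have "\<dots> = (\<Sum>m\<in>UNIV. \<Sum>i\<in>UNIV. \<Sum>j\<in>UNIV. \<Sum>k\<in>UNIV. \<Sum>l\<in>UNIV.
    pmetric M g p m l (pcoord M p) * curv (chris2 (pmetric M g p)) l i j k (pcoord M p) * W $ m * X $ i * Y $ j * Z $ k)"
    by (intro sum.cong[OF refl] sum.swap)
  finally show ?thesis by (simp add: sum_distrib_right)
qed

lemma Riem_pair_sym: "g p W (Riem M g p X Y Z) = g p Y (Riem M g p Z W X)"
proof -
  interpret local_metric "cimage (pchart M p)" "pmetric M g p" by (rule local_metric_pchart)
  show ?thesis
    unfolding g_Riem by (subst sum_swap_pairs, subst curv_pair_sym[OF x0_in]) (simp add: mult_ac)
qed

lemma Ric_expand: "Ric M g p Y Z = (\<Sum>j\<in>UNIV. \<Sum>k\<in>UNIV. ricci (pmetric M g p) (pcoord M p) $ j $ k * Y $ j * Z $ k)"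
proof -
  have "(\<Sum>i\<in>UNIV. \<Sum>j\<in>UNIV. \<Sum>k\<in>UNIV. curv (chris2 (pmetric M g p)) l i j k (pcoord M p) * axis l 1 $ i * Y $ j * Z $ k)
      = (\<Sum>i\<in>UNIV. (if i = l then 1 else 0) *
          (\<Sum>j\<in>UNIV. \<Sum>k\<in>UNIV. curv (chris2 (pmetric M g p)) l i j k (pcoord M p) * Y $ j * Z $ k))" for l
    by (simp add: axis_def sum_distrib_left mult_ac)
  then have "Ric M g p Y Z
      = (\<Sum>l\<in>UNIV. \<Sum>j\<in>UNIV. \<Sum>k\<in>UNIV. curv (chris2 (pmetric M g p)) l l j k (pcoord M p) * Y $ j * Z $ k)"
    unfolding Ric_def trace_matrix Riem_component
    by (simp add: if_distrib[of "\<lambda>u. u * _"] cong: if_cong)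
  then show ?thesis unfolding ricci_def by (subst (asm) sum_rotate) (simp add: sum_distrib_right)
qed

lemma Ric_sym: "Ric M g p Y Z = Ric M g p Z Y"
proof -
  interpret local_metric "cimage (pchart M p)" "pmetric M g p" by (rule local_metric_pchart)
  show ?thesis
    unfolding Ric_expand by (subst sum.swap) (simp add: ricci_sym[OF x0_in] mult_ac)
qed

lemma bilinear_Ric: "bilinear (Ric M g p)"
  unfolding bilinear_def
  by (auto intro!: linearI simp: Ric_expand sum.distrib distrib_left distrib_right sum_distrib_left mult_ac)

lemma RicOp_eq: "RicOp M g p X = (matrix_inv (\<chi> i j. pmetric M g p i j (pcoord M p)) ** ricci (pmetric M g p) (pcoord M p)) *v X"
  and g_RicOp: "g p (RicOp M g p X) Y = Ric M g p X Y"
proof -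
  interpret local_metric "cimage (pchart M p)" "pmetric M g p" by (rule local_metric_pchart)
  let ?A = "\<chi> i j. pmetric M g p i j (pcoord M p)"
  let ?V = "(matrix_inv ?A ** ricci (pmetric M g p) (pcoord M p)) *v X"
  have V: "g p ?V Y = Ric M g p X Y" for Y
  proof -
    have AV: "?A *v ?V = ricci (pmetric M g p) (pcoord M p) *v X"
      unfolding matrix_vector_mul_assoc matrix_mul_assoc matrix_inv_right[OF inv_G[OF x0_in]] by simp
    have "g p v Y = (\<Sum>i\<in>UNIV. Y $ i * (?A *v v) $ i)" for v
      by (subst sr_sym[OF sr p], subst g_expand)
        (simp add: matrix_vector_mult_def sum_distrib_left mult_ac)
    then have "g p ?V Y = (\<Sum>i\<in>UNIV. Y $ i * (?A *v ?V) $ i)" .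
    also have "\<dots> = Ric M g p Y X"
      unfolding AV Ric_expand by (simp add: matrix_vector_mult_def sum_distrib_left mult_ac)
    finally show ?thesis using Ric_sym by simp
  qed
  have "RicOp M g p X = ?V"
    unfolding RicOp_def
  proof (rule the_equality)
    show "\<forall>Y. g p ?V Y = Ric M g p X Y" using V by blast
    fix W assume W: "\<forall>Y. g p W Y = Ric M g p X Y"
    have lin: "linear (\<lambda>v. g p v Y)" for Y using sr_bilinear[OF sr p] unfolding bilinear_def by blast
    have "g p (W - ?V) Y = 0" for Y using W V linear_diff[OF lin] by simp
    then show "W = ?V" using sr_nondegenerate[OF sr p, of "W - ?V"] by simp
  qed
  then show "RicOp M g p X = ?V" "g p (RicOp M g p X) Y = Ric M g p X Y" using V by simp_all
qed

lemma scal_eq: "scal M g p = scalar (pmetric M g p) (pcoord M p)"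
proof -
  have "RicOp M g p = (*v) (matrix_inv (\<chi> i j. pmetric M g p i j (pcoord M p)) ** ricci (pmetric M g p) (pcoord M p))"
    using RicOp_eq by blast
  then show ?thesis by (simp add: scal_def scalar_def)
qed

end

text \<open>The preferred chart at \<open>p\<close>, through which the scalar curvature at \<open>p\<close> is defined, need not depend
  on \<open>p\<close> in any regular way; \<open>scalar_pull\<close> replaces it by the chart in which smoothness is tested.\<close>

lemma smooth_function_scal: "smooth_function M (scal M g)"
  unfolding smooth_function_def
proof
  fix c assume c: "c \<in> atlas M"
  note ch = is_chart_atlas[OF sr_manifold[OF sr] c]
  have op: "open (cimage c)" using ch by (simp add: is_chart_def)
  interpret local_metric "cimage c" "gcomp M g c"
    by (rule local_metric_gcomp[OF sr c op order_refl])
  have "(scal M g \<circ> cinv c) x = scalar (gcomp M g c) x" if "x \<in> cimage c" for x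
  proof -
    define q where "q = cinv c x"
    have q: "q \<in> fst c" "x = snd c q" using cinv_in[OF ch that] snd_cinv[OF ch that] by (simp_all add: q_def)
    have qM: "q \<in> carrier M" using fst_carrier[OF sr_manifold[OF sr] c q(1)] .
    let ?P = "pchart M q"
    have "x \<in> overlap c ?P"
      using q pchart_fst[OF sr_manifold[OF sr] qM] by (simp add: overlap_def)
    from metric_change.scalar_pull[OF metric_change_transition[OF sr c pchart_atlas[OF sr_manifold[OF sr] qM]] this] show ?thesis
      by (simp add: q(2) transition_snd[OF ch q(1)] cinv_snd[OF ch q(1)] scal_eq[OF qM])
  qed
  then show "smooth_on (cimage c) (scal M g \<circ> cinv c)"
    using smooth_scalar smooth_on_cong[OF op] by (metis (no_types, lifting))
qed

end

section \<open>The nullity condition and Ricci-semisymmetry\<close>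

context
  fixes M :: "('p::{t2_space, second_countable_topology}, 'n::finite) mfd"
    and g :: "('p, 'n) metric" and \<xi> :: "'p \<Rightarrow> real^'n" and k \<epsilon> :: real and p :: 'p
  assumes N: "nullity_manifold M g k \<xi> \<epsilon>" and p: "p \<in> carrier M"
begin

lemma nullity_semi_riemannian: "semi_riemannian M g"
  using N unfolding nullity_manifold_def by blast

lemma Riem_xi: "Riem M g p X Y (\<xi> p) = k *\<^sub>R (g p Y (\<xi> p) *\<^sub>R X - g p X (\<xi> p) *\<^sub>R Y)"
  using N p unfolding nullity_manifold_def nullity_def by blast

lemma g_xi_xi: "g p (\<xi> p) (\<xi> p) = \<epsilon>" and eps_sq: "\<epsilon> * \<epsilon> = 1"
  using N p unfolding nullity_manifold_def by auto

lemma Ric_xi: "Ric M g p Y (\<xi> p) = k * (real CARD('n) - 1) * g p Y (\<xi> p)"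
proof -
  have "g p Y (\<xi> p) = (\<Sum>l\<in>UNIV. Y $ l * g p (axis l 1) (\<xi> p))"
  proof -
    have lin: "linear (\<lambda>v. g p v (\<xi> p))" using sr_bilinear[OF nullity_semi_riemannian p] unfolding bilinear_def by blast
    have "g p Y (\<xi> p) = g p (\<Sum>l\<in>UNIV. Y $ l *\<^sub>R axis l 1) (\<xi> p)" using axis_expand[of Y] by simp
    then show ?thesis by (simp add: linear_sum[OF lin] linear_cmul[OF lin])
  qed
  moreover have "Ric M g p Y (\<xi> p) = k * (real CARD('n) * g p Y (\<xi> p) - (\<Sum>l\<in>UNIV. Y $ l * g p (axis l 1) (\<xi> p)))"
    unfolding Ric_def trace_matrix Riem_xi by (simp add: sum_subtractf sum_distrib_left[symmetric] mult_ac)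
  ultimately show ?thesis by (simp add: algebra_simps)
qed

text \<open>The nullity condition determines $R(X,Y)\xi$ only; the pair symmetry turns it into information
  on $R(\xi,Y)U$.\<close>

lemma g_Riem_xi: "g p (Riem M g p (\<xi> p) Y U) (\<xi> p) = k * (\<epsilon> * g p Y U - g p Y (\<xi> p) * g p U (\<xi> p))"
proof -
  have lin: "linear (g p Y)" using sr_bilinear[OF nullity_semi_riemannian p] unfolding bilinear_def by blast
  have "g p (Riem M g p (\<xi> p) Y U) (\<xi> p) = g p Y (Riem M g p U (\<xi> p) (\<xi> p))"
    using Riem_pair_sym[OF nullity_semi_riemannian p] sr_sym[OF nullity_semi_riemannian p] by metis
  then show ?thesis
    by (simp add: Riem_xi g_xi_xi linear_cmul[OF lin] linear_diff[OF lin] algebra_simps)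
qed

text \<open>The semisymmetry condition $S(\mathcal{T}_a(X',Y')U,V) + S(U,\mathcal{T}_a(X',Y')V) = 0$ for
  $X' = V = \xi$, $Y' = X$ and $U = Y$, evaluated term by term.\<close>

lemma semisymmetric_identity:
  fixes X Y :: "real^'n"
  assumes semi: "Ta_Ricci_semisymmetric a M g"
  defines "c \<equiv> k * (real CARD('n) - 1)" and "x \<equiv> g p X (\<xi> p)" and "y \<equiv> g p Y (\<xi> p)"
  shows "\<epsilon> * a 5 * Ric2 M g p X Y
    = (\<epsilon> * k * a 0 + \<epsilon> * a 7 * scal M g p - \<epsilon> * c * a 1 - \<epsilon> * c * a 2) * Ric M g p X Y
      - \<epsilon> * c * (k * a 0 + c * a 4 + a 7 * scal M g p) * g p X Y
      - c\<^sup>2 * (a 1 + a 2 + 2 * a 3 + a 4 + a 5 + 2 * a 6) * (x * y)"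
proof -
  let ?\<xi> = "\<xi> p" and ?S = "Ric M g p" and ?g = "g p" and ?Q = "RicOp M g p"
  note sym = sr_sym[OF nullity_semi_riemannian p]
  have lg: "linear (\<lambda>v. ?g v w)" for w using sr_bilinear[OF nullity_semi_riemannian p] unfolding bilinear_def by blast
  have lS: "linear (?S v)" for v using bilinear_Ric[OF nullity_semi_riemannian p] unfolding bilinear_def by blast
  note lgs = linear_add[OF lg] linear_diff[OF lg] linear_cmul[OF lg]
  note lSs = linear_add[OF lS] linear_diff[OF lS] linear_cmul[OF lS]
  note gQ = g_RicOp[OF nullity_semi_riemannian p]
  have S\<xi>: "?S v ?\<xi> = c * ?g v ?\<xi>" for v unfolding c_def by (rule Ric_xi)
  have \<xi>S: "?S ?\<xi> v = c * ?g v ?\<xi>" for v using S\<xi> Ric_sym[OF nullity_semi_riemannian p] by metis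
  have \<xi>g: "?g ?\<xi> v = ?g v ?\<xi>" for v by (rule sym)
  have Q2: "?S Y (?Q X) = Ric2 M g p X Y" unfolding Ric2_def by (rule Ric_sym[OF nullity_semi_riemannian p])
  have SQ\<xi>: "?S v (?Q ?\<xi>) = c * ?S v ?\<xi>" for v
  proof -
    have "?S v (?Q ?\<xi>) = ?S (?Q ?\<xi>) v" by (rule Ric_sym[OF nullity_semi_riemannian p])
    also have "\<dots> = ?g (?Q v) (?Q ?\<xi>)" using gQ sym Ric_sym[OF nullity_semi_riemannian p] by metis
    also have "\<dots> = c * ?g (?Q v) ?\<xi>" using gQ \<xi>S sym by metis
    finally show ?thesis using gQ by simp
  qed
  have "?S (Ta a M g p ?\<xi> X Y) ?\<xi> + ?S Y (Ta a M g p ?\<xi> X ?\<xi>) = 0"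
    using semi p unfolding Ta_Ricci_semisymmetric_def by blast
  moreover have "?S (Ta a M g p ?\<xi> X Y) ?\<xi> = c * (a 0 * k * (\<epsilon> * ?g X Y - x * y)
      + a 1 * ?S X Y * \<epsilon> + a 2 * c * y * x + a 3 * c * x * y + a 4 * ?g X Y * c * \<epsilon>
      + a 5 * y * c * x + a 6 * x * c * y + a 7 * scal M g p * (?g X Y * \<epsilon> - y * x))"
    unfolding S\<xi> Ta_def lgs gQ \<xi>S \<xi>g[of X] \<xi>g[of Y] g_Riem_xi g_xi_xi S\<xi> x_def y_def by (simp add: algebra_simps)
  moreover have "?S Y (Ta a M g p ?\<xi> X ?\<xi>) = a 0 * k * (x * c * y - \<epsilon> * ?S X Y)
      + a 1 * c * x * c * y + a 2 * c * \<epsilon> * ?S X Y + a 3 * c * x * c * y + a 4 * x * c * c * y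
      + a 5 * \<epsilon> * Ric2 M g p X Y + a 6 * x * c * c * y + a 7 * scal M g p * (x * c * y - \<epsilon> * ?S X Y)"
    unfolding Ta_def Riem_xi lSs SQ\<xi> Q2 S\<xi> \<xi>S \<xi>g[of X] \<xi>g[of Y] g_xi_xi x_def y_def
    by (simp add: Ric_sym[OF nullity_semi_riemannian p, of Y X] algebra_simps)
  ultimately show ?thesis by (simp add: algebra_simps power2_eq_square)
qed

end

text \<open>The shape of the coefficients $-F/E$ and $-G/E$, as functions of the scalar curvature \<open>f\<close>.\<close>

lemma smooth_function_affine_quotient:
  assumes "\<And>c. c \<in> atlas M \<Longrightarrow> is_chart c" "smooth_function M f" "\<And>p. p \<in> carrier M \<Longrightarrow> u + v * f p \<noteq> 0"
  shows "smooth_function M (\<lambda>p. (s + t * f p) / (u + v * f p))"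
  unfolding smooth_function_def
proof
  fix c assume c: "c \<in> atlas M"
  have op: "open (cimage c)" using assms(1)[OF c] by (simp add: is_chart_def)
  have f: "smooth_on (cimage c) (\<lambda>x. f (cinv c x))"
    using assms(2) c unfolding smooth_function_def by (simp add: o_def)
  have "cinv c x \<in> carrier M" if "x \<in> cimage c" for x
    using cinv_in[OF assms(1)[OF c] that] c unfolding carrier_def by blast
  then have "smooth_on (cimage c) (\<lambda>x. (s + t * f (cinv c x)) / (u + v * f (cinv c x)))"
    by (intro smooth_on_divide smooth_on_add smooth_on_mult smooth_on_const op f assms(3))
  then show "smooth_on (cimage c) ((\<lambda>p. (s + t * f p) / (u + v * f p)) \<circ> cinv c)"
    by (simp add: o_def)
qed

theorem theorem7p6:
  fixes M :: "('p::{t2_space, second_countable_topology}, 'n::finite) mfd"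
    and g :: "('p, 'n) metric"
    and \<xi> :: "'p \<Rightarrow> real^'n"
    and a :: "nat \<Rightarrow> real"
    and k \<epsilon> n G :: real
    and r E F :: "'p \<Rightarrow> real"
  assumes "nullity_manifold M g k \<xi> \<epsilon>"
    and "Ta_Ricci_semisymmetric a M g"
    and "n = real CARD('n)"
    and "r = scal M g"
    and "E = (\<lambda>p. \<epsilon> * k * a 0 + \<epsilon> * a 7 * r p - \<epsilon> * k * (n - 1) * a 1 - \<epsilon> * k * (n - 1) * a 2)"
    and "F = (\<lambda>p. - \<epsilon> * k * (n - 1) * (k * a 0 + k * (n - 1) * a 4 + a 7 * r p))"
    and "G = - (k\<^sup>2) * (n - 1)\<^sup>2 * (a 1 + a 2 + 2 * a 3 + a 4 + a 5 + 2 * a 6)"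
  shows "(\<forall>p\<in>carrier M. \<forall>X Y. \<epsilon> * a 5 * Ric2 M g p X Y =
            E p * Ric M g p X Y + F p * g p X Y + G * (eta g \<xi> \<epsilon> p X * eta g \<xi> \<epsilon> p Y))
       \<and> (a 5 = 0 \<and> (\<forall>p\<in>carrier M. E p \<noteq> 0) \<longrightarrow> eta_Einstein M g \<xi> \<epsilon>)"
proof -
  have id: "\<epsilon> * a 5 * Ric2 M g p X Y =
      E p * Ric M g p X Y + F p * g p X Y + G * (eta g \<xi> \<epsilon> p X * eta g \<xi> \<epsilon> p Y)"
    if p: "p \<in> carrier M" for p X Y
  proof -
    have "eta g \<xi> \<epsilon> p X * eta g \<xi> \<epsilon> p Y = (\<epsilon> * \<epsilon>) * (g p X (\<xi> p) * g p Y (\<xi> p))"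
      by (simp add: eta_def)
    then have eta: "eta g \<xi> \<epsilon> p X * eta g \<xi> \<epsilon> p Y = g p X (\<xi> p) * g p Y (\<xi> p)"
      by (simp add: eps_sq[OF assms(1) p])
    show ?thesis
      using semisymmetric_identity[OF assms(1) p assms(2), of X Y]
      unfolding eta by (simp add: assms(3-7) power_mult_distrib mult.assoc)
  qed
  have "eta_Einstein M g \<xi> \<epsilon>" if a5: "a 5 = 0" and E: "\<And>p. p \<in> carrier M \<Longrightarrow> E p \<noteq> 0"
  proof -
    have sr: "semi_riemannian M g" using assms(1) unfolding nullity_manifold_def by blast
    have smooth: "smooth_function M (\<lambda>p. (s + t * scal M g p) / (u + v * scal M g p))"
      if "\<And>p. p \<in> carrier M \<Longrightarrow> u + v * scal M g p \<noteq> 0" for s t u v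
      by (rule smooth_function_affine_quotient[OF _ smooth_function_scal[OF sr] that])
        (simp_all add: is_chart_atlas[OF sr_manifold[OF sr]])
    let ?u = "\<epsilon> * k * a 0 - \<epsilon> * k * (n - 1) * a 1 - \<epsilon> * k * (n - 1) * a 2"
    have Eq: "E p = ?u + \<epsilon> * a 7 * scal M g p" for p by (simp add: assms(4,5))
    have nz: "?u + \<epsilon> * a 7 * scal M g p \<noteq> 0" if "p \<in> carrier M" for p
      using E[OF that] unfolding Eq .
    have "smooth_function M (\<lambda>p. - F p / E p)"
    proof -
      have "(\<lambda>p. - F p / E p) = (\<lambda>p. (\<epsilon> * k * (n - 1) * (k * a 0 + k * (n - 1) * a 4)
          + \<epsilon> * k * (n - 1) * a 7 * scal M g p) / (?u + \<epsilon> * a 7 * scal M g p))"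
        unfolding Eq by (simp add: assms(4,6) algebra_simps)
      then show ?thesis using smooth[OF nz] by simp
    qed
    moreover have "smooth_function M (\<lambda>p. - G / E p)"
      unfolding Eq using smooth[OF nz, of "- G" 0] by simp
    moreover have "Ric M g p X Y = - F p / E p * g p X Y + - G / E p * (eta g \<xi> \<epsilon> p X * eta g \<xi> \<epsilon> p Y)"
      if "p \<in> carrier M" for p X Y
    proof -
      have "E p * Ric M g p X Y = - F p * g p X Y - G * (eta g \<xi> \<epsilon> p X * eta g \<xi> \<epsilon> p Y)"
        using id[OF that, of X Y] a5 by simp
      then show ?thesis using E[OF that] by (simp add: field_simps)
    qed
    ultimately show ?thesis unfolding eta_Einstein_def by blast
  qed
  with id show ?thesis by blast
qed

end
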